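(* Let $G$ be an arbitrary finitely generated group. Then: (1) If $H$ is a strongly quasiconvex subgroup of $G$, then $H$ is finitely generated and undistorted in $G$, and $H$ has finite index in its commensurator $\mathrm{Comm}_G(H)$. (2) If $H_1$ and $H_2$ are arbitrary strongly quasiconvex subgroups of $G$, then $H_1\cap H_2$ is strongly quasiconvex in $G$, in $H_1$, and in $H_2$. (3) If $\mathcal{H}=\{H_1,\dots,H_\ell\}$ is a finite collection of strongly quasiconvex subgroups of $G$, then $\mathcal{H}$ has finite height, finite width, and bounded packing.
   Context: A map $\Phi:X\to Y$ of metric spaces is a $(K,L)$-quasi-isometric embedding if $\frac1K d_X(x_1,x_2)-L\le d_Y(\Phi(x_1),\Phi(x_2))\le K d_X(x_1,x_2)+L$ for all $x_1,x_2$. A $(K,L)$-quasi-geodesic is a $(K,L)$-quasi-isometric embedding of an interval of $\mathbb{R}$. A subset $A$ of a geodesic space $X$ is Morse if for every $K\ge 1$, $C\ge 0$ there is $M=M(K,C)$ such that every $(K,C)$-quasi-geodesic with endpoints on $A$ is contained in the $M$-neighborhood of $A$. A subgroup $H$ of a finitely generated group $G$ is strongly quasiconvex in $G$ if $H$ is a Morse subset of the Cayley graph of $G$ with respect to some (equivalently any) finite generating set. A finitely generated subgroup $H\le G$ is undistorted if the inclusion induces a quasi-isometric embedding of Cayley graphs (for finite generating sets). The commensurator is $\mathrm{Comm}_G(H)=\{g\in G : [H:H\cap gHg^{-1}]<\infty,\ [gHg^{-1}:H\cap gHg^{-1}]<\infty\}$. Let $\mathcal{H}=\{H_1,\dots,H_\ell\}$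 be a finite collection of subgroups of $G$. Conjugates $g_1H_{\sigma(1)}g_1^{-1},\dots,g_kH_{\sigma(k)}g_k^{-1}$ are essentially distinct if the cosets $g_1H_{\sigma(1)},\dots,g_kH_{\sigma(k)}$ are distinct. $\mathcal{H}$ has height at most $n$ if the intersection of any $n+1$ essentially distinct conjugates is finite; the height is the least such $n$, and $\mathcal H$ has finite height if such an $n$ exists. The width of $\mathcal{H}$ is the maximal cardinality of a collection of distinct cosets $\{g_iH_{\sigma(i)}\}$ such that $g_iH_{\sigma(i)}g_i^{-1}\cap g_jH_{\sigma(j)}g_j^{-1}$ is infinite for all pairs $i,j$. $\mathcal{H}$ has bounded packing if for every $D\ge 0$ there is $N\in\mathbb{N}$ such that for any collection of $N$ distinct cosets $gH_i$ with $H_i\in\mathcal{H}$, at least two are separated by a distance of at least $D$ in a fixed Cayley graph of $G$ with respect to a finite generating set.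
   Formalization: The claim that H has finite index in Comm_G(H) is stated only when H is infinite or G is finite; for finite H in an infinite G it is false, since then Comm_G(H)=G (e.g. the trivial subgroup of Z). *)

theory Defs
  imports "HOL-Analysis.Analysis" "HOL-Algebra.Generated_Groups"
begin

section \<open>Coarse geometry of metric spaces\<close>

definition qi_embedding :: "'a metric \<Rightarrow> 'b metric \<Rightarrow> real \<Rightarrow> real \<Rightarrow> ('a \<Rightarrow> 'b) \<Rightarrow> bool" where
  "qi_embedding X Y K L \<Phi> \<longleftrightarrow>
     \<Phi> \<in> mspace X \<rightarrow> mspace Y \<and>
     (\<forall>x\<^sub>1\<in>mspace X. \<forall>x\<^sub>2\<in>mspace X.
        1 / K * mdist X x\<^sub>1 x\<^sub>2 - L \<le> mdist Y (\<Phi> x\<^sub>1) (\<Phi> x\<^sub>2) \<and>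
        mdist Y (\<Phi> x\<^sub>1) (\<Phi> x\<^sub>2) \<le> K * mdist X x\<^sub>1 x\<^sub>2 + L)"

definition quasi_geodesic :: "'a metric \<Rightarrow> real \<Rightarrow> real \<Rightarrow> real set \<Rightarrow> (real \<Rightarrow> 'a) \<Rightarrow> bool" where
  "quasi_geodesic X K L I c \<longleftrightarrow>
     is_interval I \<and> qi_embedding (submetric euclidean_metric I) X K L c"

text \<open>Only a quasi-geodesic parametrized by a compact interval has two endpoints.\<close>

definition morse_subset :: "'a metric \<Rightarrow> 'a set \<Rightarrow> bool" where
  "morse_subset X A \<longleftrightarrow>
     A \<subseteq> mspace X \<and>
     (\<forall>K\<ge>1. \<forall>C\<ge>0. \<exists>M. \<forall>a b c.
        a \<le> b \<and> quasi_geodesic X K C {a..b} c \<and> c a \<in> A \<and> c b \<in> A \<longrightarrow>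
        (\<forall>t\<in>{a..b}. \<exists>x\<in>A. mdist X (c t) x \<le> M))"

definition set_distance :: "'a metric \<Rightarrow> 'a set \<Rightarrow> 'a set \<Rightarrow> real" where
  "set_distance X A B = (INF (a, b)\<in>A \<times> B. mdist X a b)"


section \<open>Geometric realization of a connected graph\<close>

text \<open>
  A graph is given by a vertex set \<open>V\<close> and a symmetric irreflexive relation \<open>E\<close>. A point
  of its geometric realization is written in barycentric coordinates, that is, as a function
  on the vertices: \<open>vertex_point u\<close> is the vertex \<open>u\<close>, and \<open>edge_point u v t\<close> is the point
  at distance \<open>t\<close> from \<open>u\<close> on the edge from \<open>u\<close> to \<open>v\<close>.
\<close>

definition vertex_point :: "'a \<Rightarrow> 'a \<Rightarrow> real" where
  "vertex_point u = (\<lambda>w. if w = u then 1 else 0)"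

definition edge_point :: "'a \<Rightarrow> 'a \<Rightarrow> real \<Rightarrow> 'a \<Rightarrow> real" where
  "edge_point u v t = (\<lambda>w. (1 - t) * vertex_point u w + t * vertex_point v w)"

definition graph_points :: "'a set \<Rightarrow> ('a \<times> 'a) set \<Rightarrow> ('a \<Rightarrow> real) set" where
  "graph_points V E =
     vertex_point ` V \<union> {edge_point u v t |u v t. (u, v) \<in> E \<and> 0 \<le> t \<and> t \<le> 1}"

definition vertex_distance :: "('a \<times> 'a) set \<Rightarrow> 'a \<Rightarrow> 'a \<Rightarrow> nat" where
  "vertex_distance E u v = (LEAST n. (u, v) \<in> E ^^ n)"

definition coord_supp :: "('a \<Rightarrow> real) \<Rightarrow> 'a set" where
  "coord_supp p = {w. p w \<noteq> 0}"

text \<open>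
  The path metric for which every edge has length 1. Two points of a common edge are joined by
  a subsegment of it, whose length is half the \<open>\<ell>\<^sup>1\<close>-distance of the coordinates. Otherwise a
  shortest path leaves \<open>p\<close> through an end \<open>u\<close> of its edge (at distance \<open>1 - p u\<close>), follows a
  shortest edge path, and reaches \<open>q\<close> through an end \<open>v\<close> of the edge of \<open>q\<close>.
\<close>

definition graph_distance :: "('a \<times> 'a) set \<Rightarrow> ('a \<Rightarrow> real) \<Rightarrow> ('a \<Rightarrow> real) \<Rightarrow> real" where
  "graph_distance E p q =
     (if \<exists>(u, v)\<in>E. coord_supp p \<union> coord_supp q \<subseteq> {u, v}
      then (\<Sum>w\<in>coord_supp p \<union> coord_supp q. \<bar>p w - q w\<bar>) / 2
      else Min ((\<lambda>(u, v). (1 - p u) + real (vertex_distance E u v) + (1 - q v)) `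
                  (coord_supp p \<times> coord_supp q)))"

definition graph_metric :: "'a set \<Rightarrow> ('a \<times> 'a) set \<Rightarrow> ('a \<Rightarrow> real) metric" where
  "graph_metric V E =
     metric (graph_points V E,
       \<lambda>p q. if p \<in> graph_points V E \<and> q \<in> graph_points V E then graph_distance E p q else 0)"

text \<open>
  The abstract type \<open>'a metric\<close> identifies a pair that is not a metric space with an arbitrary
  value, so the following facts are what gives \<open>graph_metric\<close> its meaning.
\<close>

locale connected_graph =
  fixes V :: "'a set" and E :: "('a \<times> 'a) set"
  assumes edges: "E \<subseteq> V \<times> V"
    and sym: "(u, v) \<in> E \<Longrightarrow> (v, u) \<in> E"
    and irrefl: "(u, u) \<notin> E"
    and connected: "u \<in> V \<Longrightarrow> v \<in> V \<Longrightarrow> (u, v) \<in> E\<^sup>*"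
begin

abbreviation gd where "gd \<equiv> vertex_distance E"

lemma gd_le: "(u, v) \<in> E ^^ n \<Longrightarrow> gd u v \<le> n"
  unfolding vertex_distance_def by (rule Least_le)

lemma gd_walk:
  assumes "u \<in> V" "v \<in> V"
  shows "(u, v) \<in> E ^^ gd u v"
proof -
  obtain n where "(u, v) \<in> E ^^ n"
    using connected[OF assms] rtrancl_imp_relpow by blast
  then show ?thesis unfolding vertex_distance_def by (rule LeastI)
qed

lemma gd_refl [simp]: "gd u u = 0"
  using gd_le[of u u 0] by simp

lemma gd_eq_0: "u \<in> V \<Longrightarrow> v \<in> V \<Longrightarrow> gd u v = 0 \<Longrightarrow> u = v"
  using gd_walk[of u v] by simp

lemma gd_triangle:
  assumes "u \<in> V" "v \<in> V" "w \<in> V"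
  shows "gd u w \<le> gd u v + gd v w"
  using gd_walk[OF assms(1,2)] gd_walk[OF assms(2,3)]
  by (intro gd_le) (auto simp: relpow_add)

lemma gd_edge: "(u, v) \<in> E \<Longrightarrow> gd u v \<le> 1"
  by (rule gd_le) simp

lemma walk_sym: "(u, v) \<in> E ^^ n \<Longrightarrow> (v, u) \<in> E ^^ n"
proof (induction n arbitrary: v)
  case (Suc n)
  then obtain w where "(u, w) \<in> E ^^ n" "(w, v) \<in> E" by auto
  show ?case using relpow_Suc_I2[OF sym[OF \<open>(w, v) \<in> E\<close>] Suc.IH[OF \<open>(u, w) \<in> E ^^ n\<close>]] .
qed simp

lemma gd_sym:
  assumes "u \<in> V" "v \<in> V"
  shows "gd u v = gd v u"
  using gd_le[OF walk_sym[OF gd_walk[OF assms]]] gd_le[OF walk_sym[OF gd_walk[OF assms(2,1)]]]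
  by simp

abbreviation pts where "pts \<equiv> graph_points V E"

lemma supp_vertex [simp]: "coord_supp (vertex_point u) = {u}"
  by (auto simp: coord_supp_def vertex_point_def)

lemma edge_other:
  assumes "(a, b) \<in> E" "S \<subseteq> {a, b}" "u \<in> {a, b}"
  obtains c where "(u, c) \<in> E" "S \<subseteq> {u, c}"
proof (cases "u = a")
  case True
  then show ?thesis using that[of b] assms by simp
next
  case False
  then show ?thesis using that[of a] assms sym[of a b] by auto
qed

lemma point_cases:
  assumes "p \<in> pts"
  obtains (vertex) u where "u \<in> V" "p = vertex_point u" "coord_supp p = {u}"
  | (edge) u v where "(u, v) \<in> E" "coord_supp p = {u, v}" "u \<noteq> v" "p u + p v = 1"
      "0 < p u" "0 < p v"
proof -
  from assms consider u where "u \<in> V" "p = vertex_point u"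
    | u v t where "(u, v) \<in> E" "0 \<le> t" "t \<le> 1" "p = edge_point u v t"
    unfolding graph_points_def by blast
  then show thesis
  proof cases
    case 1
    then show ?thesis using vertex by simp
  next
    case (2 u v t)
    from 2(1) edges irrefl have uv: "u \<in> V" "v \<in> V" "u \<noteq> v" by auto
    consider "t = 0" | "t = 1" | "0 < t" "t < 1" using 2 by linarith
    then show ?thesis
    proof cases
      case 1
      then have "p = vertex_point u" using 2 by (auto simp: edge_point_def)
      then show ?thesis using vertex uv by simp
    next
      case one: 2
      then have "p = vertex_point v" using 2 by (auto simp: edge_point_def)
      then show ?thesis using vertex uv by simp
    next
      case 3
      have "p u = 1 - t" "p v = t" "\<And>w. w \<noteq> u \<Longrightarrow> w \<noteq> v \<Longrightarrow> p w = 0"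
        using 2 uv by (auto simp: edge_point_def vertex_point_def)
      moreover from this 3 have "coord_supp p = {u, v}" by (auto simp: coord_supp_def)
      ultimately show ?thesis using edge[of u v] 2 uv 3 by simp
    qed
  qed
qed

lemma supp_facts:
  assumes "p \<in> pts"
  shows "finite (coord_supp p)" "coord_supp p \<noteq> {}" "coord_supp p \<subseteq> V"
  using assms edges by (cases rule: point_cases; auto)+

lemma coord_bounds:
  assumes "p \<in> pts"
  shows "0 \<le> p w" "p w \<le> 1"
proof -
  have "0 \<le> p w \<and> p w \<le> 1"
    using assms
  proof (cases rule: point_cases)
    case (vertex u)
    then show ?thesis by (simp add: vertex_point_def)
  next
    case (edge u v)
    consider "w = u" | "w = v" | "w \<notin> coord_supp p" using edge by auto
    then show ?thesis
    proof cases
      case 3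
      then show ?thesis by (simp add: coord_supp_def)
    qed (use edge in simp_all)
  qed
  then show "0 \<le> p w" "p w \<le> 1" by auto
qed

lemma coord_single:
  assumes "p \<in> pts" "coord_supp p \<subseteq> {u}"
  shows "p = vertex_point u"
  using assms by (cases rule: point_cases; auto)

lemma coord_sum:
  assumes "p \<in> pts" "coord_supp p \<subseteq> {a, b}" "a \<noteq> b"
  shows "p a + p b = 1"
  using assms(1)
proof (cases rule: point_cases)
  case (vertex u)
  then show ?thesis using assms by (auto simp: vertex_point_def)
next
  case (edge u v)
  then have "{u, v} = {a, b}" using assms by auto
  then show ?thesis using edge by (auto simp: doubleton_eq_iff)
qed

lemma dist_local:
  assumes "p \<in> pts" "q \<in> pts" "(a, b) \<in> E" "coord_supp p \<union> coord_supp q \<subseteq> {a, b}"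
  shows "graph_distance E p q = \<bar>p a - q a\<bar>"
proof -
  have ab: "a \<noteq> b" using assms irrefl by auto
  have "(\<Sum>w\<in>coord_supp p \<union> coord_supp q. \<bar>p w - q w\<bar>) = (\<Sum>w\<in>{a, b}. \<bar>p w - q w\<bar>)"
    using assms(4) by (intro sum.mono_neutral_left) (auto simp: coord_supp_def)
  also have "\<dots> = \<bar>p a - q a\<bar> + \<bar>p b - q b\<bar>" using ab by simp
  also have "\<dots> = 2 * \<bar>p a - q a\<bar>"
    using coord_sum[of p a b] coord_sum[of q a b] assms ab by auto
  finally show ?thesis using assms(3,4) by (auto simp: graph_distance_def)
qed

lemma dist_upper:
  assumes p: "p \<in> pts" and q: "q \<in> pts" and u: "u \<in> coord_supp p" and v: "v \<in> coord_supp q"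
  shows "graph_distance E p q \<le> (1 - p u) + real (gd u v) + (1 - q v)"
proof (cases "\<exists>(a, b)\<in>E. coord_supp p \<union> coord_supp q \<subseteq> {a, b}")
  case True
  then obtain a b where ab: "(a, b) \<in> E" "coord_supp p \<union> coord_supp q \<subseteq> {a, b}" by auto
  obtain c where c: "(u, c) \<in> E" "coord_supp p \<union> coord_supp q \<subseteq> {u, c}"
    using edge_other[OF ab, of u] ab u by blast
  have eq: "graph_distance E p q = \<bar>p u - q u\<bar>" using dist_local[OF p q c] .
  show ?thesis
  proof (cases "u = v")
    case True
    then show ?thesis using eq coord_bounds[OF p, of u] coord_bounds[OF q, of v] by auto
  next
    case False
    then have "v = c" using c v by auto
    moreover have "gd u v \<noteq> 0"
      using False gd_eq_0 u v supp_facts(3)[OF p] supp_facts(3)[OF q] by blast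
    moreover have "q u + q c = 1"
      using coord_sum[OF q, of u c] c irrefl by auto
    ultimately show ?thesis
      using eq coord_bounds[OF p, of u] coord_bounds[OF q, of u] by auto
  qed
next
  case False
  then have "graph_distance E p q = Min ((\<lambda>(u, v). (1 - p u) + real (gd u v) + (1 - q v)) `
                  (coord_supp p \<times> coord_supp q))"
    unfolding graph_distance_def by auto
  also have "\<dots> \<le> (1 - p u) + real (gd u v) + (1 - q v)"
    using u v supp_facts(1)[OF p] supp_facts(1)[OF q]
    by (intro Min_le) (auto intro!: rev_image_eqI[of "(u, v)"])
  finally show ?thesis .
qed

lemma dist_cases:
  assumes p: "p \<in> pts" and q: "q \<in> pts"
  obtains (same_edge) a b where "(a, b) \<in> E" "coord_supp p \<union> coord_supp q \<subseteq> {a, b}"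
  | (across) u v where "u \<in> coord_supp p" "v \<in> coord_supp q"
      "graph_distance E p q = (1 - p u) + real (gd u v) + (1 - q v)"
proof (cases "\<exists>(a, b)\<in>E. coord_supp p \<union> coord_supp q \<subseteq> {a, b}")
  case True
  then show ?thesis using same_edge by auto
next
  case False
  let ?F = "(\<lambda>(u, v). (1 - p u) + real (gd u v) + (1 - q v)) ` (coord_supp p \<times> coord_supp q)"
  have "graph_distance E p q = Min ?F"
    using False unfolding graph_distance_def by auto
  moreover have "Min ?F \<in> ?F"
    using supp_facts[OF p] supp_facts[OF q] by (intro Min_in) auto
  ultimately show ?thesis using across by auto
qed

definition near :: "('a \<Rightarrow> real) \<Rightarrow> 'a \<Rightarrow> bool" where
  "near p a \<longleftrightarrow> a \<in> coord_supp p \<or> (\<exists>b. (a, b) \<in> E \<and> coord_supp p \<subseteq> {a, b})"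

lemma near_edge: "(a, b) \<in> E \<Longrightarrow> coord_supp p \<subseteq> {a, b} \<Longrightarrow> near p a \<and> near p b"
  unfolding near_def using sym by (metis insert_commute)

lemma near_supp:
  assumes p: "p \<in> pts" and a: "near p a" and x: "x \<in> V"
  obtains u where "u \<in> coord_supp p" "(1 - p u) + real (gd u x) \<le> (1 - p a) + real (gd a x)"
    "a \<in> V"
proof (cases "a \<in> coord_supp p")
  case True
  then show ?thesis using that[of a] supp_facts(3)[OF p] by auto
next
  case False
  then obtain b where b: "(a, b) \<in> E" "coord_supp p \<subseteq> {a, b}"
    using a by (auto simp: near_def)
  with False have "coord_supp p \<subseteq> {b}" by auto
  then have pb: "p = vertex_point b" using coord_single[OF p] by simp
  have V: "a \<in> V" "b \<in> V" using b edges by auto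
  have "p b = 1" "p a = 0"
    using pb b irrefl[of a] by (auto simp: vertex_point_def)
  moreover have "gd b x \<le> 1 + gd a x"
    using gd_triangle[of b a x] V x gd_edge[of b a] sym[OF b(1)] by auto
  moreover have "b \<in> coord_supp p" using pb by simp
  ultimately show ?thesis using that[of b] V by auto
qed

lemma dist_upper_near:
  assumes p: "p \<in> pts" and q: "q \<in> pts" and a: "near p a" and b: "near q b"
  shows "graph_distance E p q \<le> (1 - p a) + real (gd a b) + (1 - q b)"
proof -
  obtain x where x: "x \<in> V" using supp_facts[OF p] by blast
  have aV: "a \<in> V" by (rule near_supp[OF p a x])
  have bV: "b \<in> V" by (rule near_supp[OF q b x])
  obtain v where v: "v \<in> coord_supp q" "(1 - q v) + real (gd v a) \<le> (1 - q b) + real (gd b a)"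
    by (rule near_supp[OF q b aV])
  have vV: "v \<in> V" using v(1) supp_facts(3)[OF q] by blast
  obtain u where u: "u \<in> coord_supp p" "(1 - p u) + real (gd u v) \<le> (1 - p a) + real (gd a v)"
    by (rule near_supp[OF p a vV])
  have "real (gd v a) = real (gd a v)" "real (gd b a) = real (gd a b)"
    using gd_sym[OF aV vV] gd_sym[OF aV bV] by simp_all
  then show ?thesis
    using dist_upper[OF p q u(1) v(1)] u(2) v(2) by linarith
qed

lemma dist_sym:
  assumes p: "p \<in> pts" and q: "q \<in> pts"
  shows "graph_distance E p q = graph_distance E q p"
proof -
  have le: "graph_distance E p q \<le> graph_distance E q p" if p: "p \<in> pts" and q: "q \<in> pts" for p q
    using q p
  proof (cases rule: dist_cases)
    case (same_edge a b)
    then have "coord_supp p \<union> coord_supp q \<subseteq> {a, b}" by blast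
    then show ?thesis
      using dist_local[OF p q same_edge(1)] dist_local[OF q p same_edge] by simp
  next
    case (across u v)
    have "gd u v = gd v u"
      using across supp_facts(3)[OF p] supp_facts(3)[OF q] by (intro gd_sym) auto
    then show ?thesis using dist_upper[OF p q across(2,1)] across(3) by simp
  qed
  show ?thesis using le[OF p q] le[OF q p] by simp
qed

lemma dist_triangle_LG:
  assumes p: "p \<in> pts" and q: "q \<in> pts" and r: "r \<in> pts"
    and ab: "(a, b) \<in> E" "coord_supp p \<union> coord_supp q \<subseteq> {a, b}"
    and vw: "v \<in> coord_supp q" "w \<in> coord_supp r"
      "graph_distance E q r = (1 - q v) + real (gd v w) + (1 - r w)"
  shows "graph_distance E p r \<le> graph_distance E p q + graph_distance E q r"
proof -
  obtain c where c: "(v, c) \<in> E" "coord_supp p \<union> coord_supp q \<subseteq> {v, c}"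
    using edge_other[OF ab, of v] ab vw by blast
  have "near p v" "near r w" using near_edge[of v c p] c vw(2) by (auto simp: near_def)
  from dist_upper_near[OF p r this] dist_local[OF p q c] vw(3) show ?thesis by linarith
qed

lemma dist_triangle:
  assumes p: "p \<in> pts" and q: "q \<in> pts" and r: "r \<in> pts"
  shows "graph_distance E p r \<le> graph_distance E p q + graph_distance E q r"
  using p q
proof (cases rule: dist_cases)
  case pq: (same_edge a b)
  show ?thesis using q r
  proof (cases rule: dist_cases)
    case qr: (same_edge c d)
    show ?thesis
    proof (cases "{a, b} = {c, d}")
      case True
      then have "coord_supp q \<union> coord_supp r \<subseteq> {a, b}" "coord_supp p \<union> coord_supp r \<subseteq> {a, b}"
        using pq qr by blast+
      then show ?thesis
        using dist_local[OF p q pq] dist_local[OF q r pq(1)] dist_local[OF p r pq(1)] by linarith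
    next
      case False
      have ne: "a \<noteq> b" "c \<noteq> d" using pq qr irrefl by auto
      obtain v where v: "coord_supp q = {v}"
      proof -
        have "card (coord_supp q) \<noteq> 2"
        proof
          assume "card (coord_supp q) = 2"
          then have "coord_supp q = {a, b}" "coord_supp q = {c, d}"
            using pq qr ne card_subset_eq[of "{a, b}" "coord_supp q"]
              card_subset_eq[of "{c, d}" "coord_supp q"] by auto
          then show False using False by simp
        qed
        with q that show thesis by (cases rule: point_cases; auto)
      qed
      then have qv: "q v = 1" using coord_single[OF q, of v] by (auto simp: vertex_point_def)
      obtain b' where b': "(v, b') \<in> E" "coord_supp p \<union> coord_supp q \<subseteq> {v, b'}"
        using edge_other[OF pq, of v] pq v by blast
      obtain d' where d': "(v, d') \<in> E" "coord_supp q \<union> coord_supp r \<subseteq> {v, d'}"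
        using edge_other[OF qr, of v] qr v by blast
      have "near p v" "near r v" using near_edge b' d' by auto
      from dist_upper_near[OF p r this]
      have "graph_distance E p r \<le> (1 - p v) + (1 - r v)" by simp
      then show ?thesis
        using dist_local[OF p q b'] dist_local[OF q r d'] qv
          coord_bounds[OF p, of v] coord_bounds[OF r, of v] by linarith
    qed
  next
    case (across v w)
    then show ?thesis using dist_triangle_LG[OF p q r pq] by blast
  qed
next
  case pq: (across u v)
  show ?thesis using q r
  proof (cases rule: dist_cases)
    case qr: (same_edge c d)
    have "graph_distance E q p = (1 - q v) + real (gd v u) + (1 - p u)"
    proof -
      have "gd u v = gd v u"
        using pq supp_facts(3)[OF p] supp_facts(3)[OF q] by (intro gd_sym) auto
      then show ?thesis using pq(3) dist_sym[OF p q] by simp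
    qed
    then have "graph_distance E r p \<le> graph_distance E r q + graph_distance E q p"
      using dist_triangle_LG[OF r q p, of c d v u] qr pq by auto
    then show ?thesis using dist_sym[OF r p] dist_sym[OF r q] dist_sym[OF q p] by simp
  next
    case qr: (across v' w)
    have V: "u \<in> V" "v \<in> V" "v' \<in> V" "w \<in> V"
      using pq qr supp_facts(3)[OF p] supp_facts(3)[OF q] supp_facts(3)[OF r] by auto
    have "real (gd v v') \<le> (1 - q v) + (1 - q v')"
      using q
    proof (cases rule: point_cases)
      case (vertex x)
      then have "v = x" "v' = x" using pq qr by auto
      then show ?thesis using coord_bounds[OF q, of x] by simp
    next
      case (edge x y)
      show ?thesis
      proof (cases "v = v'")
        case True
        then show ?thesis using coord_bounds[OF q, of v] by simp
      next
        case False
        then have "(v, v') \<in> E" "q v + q v' = 1" using edge pq qr sym by auto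
        then show ?thesis using gd_edge[of v v'] by simp
      qed
    qed
    moreover have "real (gd u w) \<le> real (gd u v) + real (gd v v') + real (gd v' w)"
      using gd_triangle[OF V(1,2,4)] gd_triangle[OF V(2,3,4)] by linarith
    moreover have "graph_distance E p r \<le> (1 - p u) + real (gd u w) + (1 - r w)"
      using dist_upper[OF p r] pq qr by auto
    ultimately show ?thesis using pq qr by linarith
  qed
qed

lemma dist_nonneg:
  assumes p: "p \<in> pts" and q: "q \<in> pts"
  shows "0 \<le> graph_distance E p q"
  using p q
proof (cases rule: dist_cases)
  case (same_edge a b)
  then show ?thesis using dist_local[OF p q] by simp
next
  case (across u v)
  then show ?thesis using coord_bounds[OF p, of u] coord_bounds[OF q, of v] by simp
qed

lemma dist_eq_0:
  assumes p: "p \<in> pts" and q: "q \<in> pts"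
  shows "graph_distance E p q = 0 \<longleftrightarrow> p = q"
proof
  assume eq: "graph_distance E p q = 0"
  show "p = q" using p q
  proof (cases rule: dist_cases)
    case (same_edge a b)
    have ab: "a \<noteq> b" using same_edge irrefl by auto
    have "p a = q a" using dist_local[OF p q same_edge] eq by simp
    moreover have "p b = q b"
      using coord_sum[OF p, of a b] coord_sum[OF q, of a b] same_edge ab \<open>p a = q a\<close> by auto
    moreover have "p w = q w" if "w \<noteq> a" "w \<noteq> b" for w
    proof -
      have "w \<notin> coord_supp p" "w \<notin> coord_supp q" using same_edge that by auto
      then show ?thesis by (simp add: coord_supp_def)
    qed
    ultimately show ?thesis by (metis ext)
  next
    case (across u v)
    have le: "p u \<le> 1" "q v \<le> 1" using coord_bounds[OF p] coord_bounds[OF q] by auto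
    have one: "p u = 1" "q v = 1" "gd u v = 0" using across(3) eq le by linarith+
    have uv: "u = v"
      using gd_eq_0 one across(1,2) supp_facts(3)[OF p] supp_facts(3)[OF q] by blast
    have "x = vertex_point w" if x: "x \<in> pts" "x w = 1" "w \<in> coord_supp x" for x w
      using x(1)
    proof (cases rule: point_cases)
      case (vertex u)
      then show ?thesis using x by auto
    next
      case (edge u v)
      then show ?thesis using x by auto
    qed
    then show ?thesis using p q one across uv by metis
  qed
next
  assume "p = q"
  show "graph_distance E p q = 0"
  proof (cases "\<exists>(a, b)\<in>E. coord_supp p \<union> coord_supp q \<subseteq> {a, b}")
    case True
    then show ?thesis using \<open>p = q\<close> by (auto simp: graph_distance_def)
  next
    case False
    from p show ?thesis
    proof (cases rule: point_cases)
      case (vertex u)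
      then show ?thesis
        using dist_upper[OF p p, of u u] dist_nonneg[OF p p] \<open>p = q\<close>
        by (simp add: vertex_point_def)
    next
      case (edge u v)
      then show ?thesis using False \<open>p = q\<close> by blast
    qed
  qed
qed

lemma Metric_space_graph:
  "Metric_space pts (\<lambda>p q. if p \<in> pts \<and> q \<in> pts then graph_distance E p q else 0)"
  by unfold_locales (auto simp: dist_nonneg dist_sym dist_eq_0 dist_triangle)

lemma mspace_graph [simp]: "mspace (graph_metric V E) = pts"
  unfolding graph_metric_def by (rule Metric_space.mspace_metric[OF Metric_space_graph])

lemma mdist_graph:
  "p \<in> pts \<Longrightarrow> q \<in> pts \<Longrightarrow> mdist (graph_metric V E) p q = graph_distance E p q"
  unfolding graph_metric_def by (simp add: Metric_space.mdist_metric[OF Metric_space_graph])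

lemma mdist_vertices:
  assumes "u \<in> V" "v \<in> V"
  shows "mdist (graph_metric V E) (vertex_point u) (vertex_point v) = vertex_distance E u v"
proof -
  have uv: "vertex_point u \<in> pts" "vertex_point v \<in> pts"
    using assms by (auto simp: graph_points_def)
  have "graph_distance E (vertex_point u) (vertex_point v) = gd u v"
    using uv
  proof (cases rule: dist_cases)
    case (same_edge a b)
    then obtain c where c: "(u, c) \<in> E" "{u, v} \<subseteq> {u, c}"
      using edge_other[of a b "{u, v}" u] by auto
    have eq: "graph_distance E (vertex_point u) (vertex_point v) =
        \<bar>vertex_point u u - vertex_point v u\<bar>"
      using dist_local[OF uv c(1)] c(2) by simp
    show ?thesis
    proof (cases "u = v")
      case False
      then have "gd u v \<le> 1" "gd u v \<noteq> 0"
        using c gd_edge[of u c] gd_eq_0[OF assms] by auto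
      then show ?thesis using eq False by (simp add: vertex_point_def)
    qed (use eq in simp)
  next
    case (across a b)
    then have "a = u" "b = v" by auto
    moreover have "vertex_point u u = 1" "vertex_point v v = 1"
      by (simp_all add: vertex_point_def)
    ultimately show ?thesis using across(3) by simp
  qed
  then show ?thesis using mdist_graph[OF uv] by simp
qed

end


section \<open>Cayley graphs\<close>

definition finite_generating_set :: "('a, 'b) monoid_scheme \<Rightarrow> 'a set \<Rightarrow> bool" where
  "finite_generating_set G S \<longleftrightarrow> finite S \<and> S \<subseteq> carrier G \<and> generate G S = carrier G"

definition finitely_generated :: "('a, 'b) monoid_scheme \<Rightarrow> bool" where
  "finitely_generated G \<longleftrightarrow> (\<exists>S. finite_generating_set G S)"

text \<open>Cayley graphs are simple graphs here: no loops and no multiple edges.\<close>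

definition cayley_edges :: "('a, 'b) monoid_scheme \<Rightarrow> 'a set \<Rightarrow> ('a \<times> 'a) set" where
  "cayley_edges G S =
     {(g, h). g \<in> carrier G \<and> h \<in> carrier G \<and> g \<noteq> h \<and>
        (\<exists>s\<in>S. h = g \<otimes>\<^bsub>G\<^esub> s \<or> g = h \<otimes>\<^bsub>G\<^esub> s)}"

definition cayley_graph :: "('a, 'b) monoid_scheme \<Rightarrow> 'a set \<Rightarrow> ('a \<Rightarrow> real) metric" where
  "cayley_graph G S = graph_metric (carrier G) (cayley_edges G S)"

lemma connected_cayley_graph:
  assumes "group G" and gen: "finite_generating_set G S"
  shows "connected_graph (carrier G) (cayley_edges G S)"
proof -
  interpret group G by fact
  let ?E = "cayley_edges G S"
  have S: "S \<subseteq> carrier G" "generate G S = carrier G"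
    using gen by (auto simp: finite_generating_set_def)
  have sym: "(v, u) \<in> ?E" if "(u, v) \<in> ?E" for u v
    using that by (auto simp: cayley_edges_def)
  have step: "(g, g \<otimes>\<^bsub>G\<^esub> s) \<in> ?E\<^sup>*" "(g \<otimes>\<^bsub>G\<^esub> s, g) \<in> ?E\<^sup>*"
    if "g \<in> carrier G" "s \<in> S" for g s
  proof -
    have "s \<in> carrier G" using that S by auto
    then show "(g, g \<otimes>\<^bsub>G\<^esub> s) \<in> ?E\<^sup>*" "(g \<otimes>\<^bsub>G\<^esub> s, g) \<in> ?E\<^sup>*"
      using that
      by (cases "g = g \<otimes>\<^bsub>G\<^esub> s"; auto intro!: r_into_rtrancl simp: cayley_edges_def)+
  qed
  have reach: "\<forall>g\<in>carrier G. (g, g \<otimes>\<^bsub>G\<^esub> x) \<in> ?E\<^sup>*" if "x \<in> generate G S" for x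
    using that
  proof induction
    case one
    then show ?case by simp
  next
    case (incl s)
    then show ?case using step by blast
  next
    case (inv s)
    show ?case
    proof
      fix g assume g: "g \<in> carrier G"
      have s: "s \<in> carrier G" using inv S by auto
      have "(g \<otimes>\<^bsub>G\<^esub> inv\<^bsub>G\<^esub> s \<otimes>\<^bsub>G\<^esub> s, g \<otimes>\<^bsub>G\<^esub> inv\<^bsub>G\<^esub> s) \<in> ?E\<^sup>*"
        using step(2)[OF _ inv] g s by simp
      then show "(g, g \<otimes>\<^bsub>G\<^esub> inv\<^bsub>G\<^esub> s) \<in> ?E\<^sup>*" using g s by (simp add: m_assoc)
    qed
  next
    case (eng x y)
    have "x \<in> carrier G" "y \<in> carrier G" using eng S by auto
    show ?case
    proof
      fix g assume g: "g \<in> carrier G"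
      have "(g, g \<otimes>\<^bsub>G\<^esub> x) \<in> ?E\<^sup>*" "(g \<otimes>\<^bsub>G\<^esub> x, g \<otimes>\<^bsub>G\<^esub> x \<otimes>\<^bsub>G\<^esub> y) \<in> ?E\<^sup>*"
        using eng.IH g \<open>x \<in> carrier G\<close> by auto
      then show "(g, g \<otimes>\<^bsub>G\<^esub> (x \<otimes>\<^bsub>G\<^esub> y)) \<in> ?E\<^sup>*"
        using g \<open>x \<in> carrier G\<close> \<open>y \<in> carrier G\<close> by (simp add: m_assoc)
    qed
  qed
  show ?thesis
  proof
    show "?E \<subseteq> carrier G \<times> carrier G" by (auto simp: cayley_edges_def)
    show "(u, u) \<notin> ?E" for u by (auto simp: cayley_edges_def)
    show "(v, u) \<in> ?E" if "(u, v) \<in> ?E" for u v using sym that .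
    show "(u, v) \<in> ?E\<^sup>*" if "u \<in> carrier G" "v \<in> carrier G" for u v
    proof -
      have "(u, u \<otimes>\<^bsub>G\<^esub> (inv\<^bsub>G\<^esub> u \<otimes>\<^bsub>G\<^esub> v)) \<in> ?E\<^sup>*"
        using reach S that by blast
      then show ?thesis using that by (simp add: m_assoc[symmetric])
    qed
  qed
qed


section \<open>Subgroups\<close>

definition strongly_quasiconvex :: "('a, 'b) monoid_scheme \<Rightarrow> 'a set \<Rightarrow> bool" where
  "strongly_quasiconvex G H \<longleftrightarrow>
     subgroup H G \<and>
     (\<exists>S. finite_generating_set G S \<and> morse_subset (cayley_graph G S) (vertex_point ` H))"

text \<open>
  The inclusion of \<open>H\<close> into \<open>G\<close> is defined on the vertices of the Cayley graph of \<open>H\<close>, and a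
  map of Cayley graphs is induced by it if it extends it.
\<close>

definition undistorted :: "('a, 'b) monoid_scheme \<Rightarrow> 'a set \<Rightarrow> bool" where
  "undistorted G H \<longleftrightarrow>
     subgroup H G \<and> finitely_generated (G\<lparr>carrier := H\<rparr>) \<and>
     (\<forall>S T. finite_generating_set G S \<and> finite_generating_set (G\<lparr>carrier := H\<rparr>) T \<longrightarrow>
        (\<exists>K\<ge>1. \<exists>L\<ge>0. \<exists>\<Phi>.
           (\<forall>h\<in>H. \<Phi> (vertex_point h) = vertex_point h) \<and>
           qi_embedding (cayley_graph (G\<lparr>carrier := H\<rparr>) T) (cayley_graph G S) K L \<Phi>))"

definition conjugate :: "('a, 'b) monoid_scheme \<Rightarrow> 'a \<Rightarrow> 'a set \<Rightarrow> 'a set" where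
  "conjugate G g H = (g <#\<^bsub>G\<^esub> H) #>\<^bsub>G\<^esub> inv\<^bsub>G\<^esub> g"

definition finite_index :: "('a, 'b) monoid_scheme \<Rightarrow> 'a set \<Rightarrow> 'a set \<Rightarrow> bool" where
  "finite_index G H K \<longleftrightarrow> K \<subseteq> H \<and> finite (rcosets\<^bsub>G\<lparr>carrier := H\<rparr>\<^esub> K)"

definition commensurator :: "('a, 'b) monoid_scheme \<Rightarrow> 'a set \<Rightarrow> 'a set" where
  "commensurator G H =
     {g \<in> carrier G. finite_index G H (H \<inter> conjugate G g H) \<and>
                     finite_index G (conjugate G g H) (H \<inter> conjugate G g H)}"


section \<open>Finite collections of subgroups\<close>

text \<open>
  A collection of cosets \<open>g H\<close> with \<open>H \<in> \<H>\<close> (or of the corresponding conjugates) is represented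
  by a set of pairs \<open>(g, H)\<close>; distinct pairs in it are required to have distinct cosets.
\<close>

definition essentially_distinct ::
    "('a, 'b) monoid_scheme \<Rightarrow> 'a set set \<Rightarrow> ('a \<times> 'a set) set \<Rightarrow> bool" where
  "essentially_distinct G \<H> P \<longleftrightarrow>
     P \<subseteq> carrier G \<times> \<H> \<and> inj_on (\<lambda>(g, H). g <#\<^bsub>G\<^esub> H) P"

definition height_at_most :: "('a, 'b) monoid_scheme \<Rightarrow> 'a set set \<Rightarrow> nat \<Rightarrow> bool" where
  "height_at_most G \<H> n \<longleftrightarrow>
     (\<forall>P. essentially_distinct G \<H> P \<and> card P = n + 1 \<longrightarrow>
        finite (\<Inter>(g, H)\<in>P. conjugate G g H))"

definition finite_height :: "('a, 'b) monoid_scheme \<Rightarrow> 'a set set \<Rightarrow> bool" where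
  "finite_height G \<H> \<longleftrightarrow> (\<exists>n. height_at_most G \<H> n)"

definition finite_width :: "('a, 'b) monoid_scheme \<Rightarrow> 'a set set \<Rightarrow> bool" where
  "finite_width G \<H> \<longleftrightarrow>
     (\<exists>n. \<forall>P. essentially_distinct G \<H> P \<and>
        (\<forall>(g, H)\<in>P. \<forall>(g', H')\<in>P. (g, H) \<noteq> (g', H') \<longrightarrow>
           infinite (conjugate G g H \<inter> conjugate G g' H')) \<longrightarrow>
        finite P \<and> card P \<le> n)"

definition bounded_packing :: "('a, 'b) monoid_scheme \<Rightarrow> 'a set set \<Rightarrow> bool" where
  "bounded_packing G \<H> \<longleftrightarrow>
     (\<forall>S. finite_generating_set G S \<longrightarrow>
        (\<forall>D\<ge>0. \<exists>N::nat. \<forall>P. essentially_distinct G \<H> P \<and> finite P \<and> card P = N \<longrightarrow>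
           (\<exists>(g, H)\<in>P. \<exists>(g', H')\<in>P. (g, H) \<noteq> (g', H') \<and>
              D \<le> set_distance (cayley_graph G S)
                    (vertex_point ` (g <#\<^bsub>G\<^esub> H)) (vertex_point ` (g' <#\<^bsub>G\<^esub> H')))))"

end

theory Submission
  imports Defs
begin

text \<open>
  The geometric core is one elementary construction. Put weights between 1 and \<open>L\<close> on the vertices
  of a Cayley graph; then a walk of least cost is an \<open>(L, 0)\<close>-quasi-geodesic
  (\<open>least_cost_walk_quasi_geodesic\<close>), so if its ends lie on a Morse subset \<open>A\<close>, it stays in a
  neighbourhood of \<open>A\<close> whose radius depends on \<open>A\<close> and \<open>L\<close> only. Comparing its cost with that of an explicit
  detour, for weights that make the neighbourhood of a Morse subset cheap or expensive, gives the
  geometric facts about Morse subsets \<open>A\<close> and \<open>B\<close>: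

  \<^item> If \<open>A\<close> and \<open>B\<close> stay at bounded distance along points that are arbitrarily far apart, then they come
    within a distance that depends on their Morse radii only (\<open>close_if_fellow_travelling\<close>).
  \<^item> Let \<open>x\<close> be a point of \<open>A\<close> nearest to \<open>v\<close>, at distance \<open>t\<close>. If \<open>B\<close> comes close to \<open>A\<close> and within \<open>t\<close>
    of \<open>v\<close>, then it comes within \<open>t / 2 + const\<close> of \<open>x\<close> (\<open>nearest_point_close\<close>). This is a weak form of
    the sublinear contraction property of Morse subsets.

  The second fact yields a Helly property: finitely many pairwise close Morse subsets have a common
  near point, with a constant independent of their number (\<open>common_near_point\<close>). Indeed a point that
  minimizes the largest distance \<open>t\<close> to the subsets could be improved to \<open>t / 2 + const\<close>. Applied to
  cosets, which have the same Morse radii as their subgroups, it bounds the number of pairwise close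
  distinct cosets, because only finitely many cosets meet a ball: this is bounded packing. Conjugates
  with infinite intersection belong to cosets that fellow-travel, hence are close by the first fact;
  so bounded packing gives finite width, and finite width gives finite height. Subgroups that are
  commensurable with an infinite \<open>H\<close> have infinite intersections, so finite height of \<open>{H}\<close> bounds the
  index of \<open>H\<close> in its commensurator.

  The other statements need only that quasi-geodesics stay near: geodesics between elements of \<open>H\<close>
  stay near \<open>H\<close>, which makes \<open>H\<close> finitely generated and undistorted (\<open>quasiconvex_generating_set\<close>); and
  in a group, a point near two subgroups is near their intersection (\<open>near_intersection\<close>). All this is
  done on vertices; Morse subsets of the geometric realization are related to sequences of vertices at
  the beginning.
\<close>


section \<open>Discrete quasi-geodesics and the Morse property\<close>

definition vertex_quasi_geodesic ::
    "('a \<times> 'a) set \<Rightarrow> 'a set \<Rightarrow> real \<Rightarrow> real \<Rightarrow> nat \<Rightarrow> (nat \<Rightarrow> 'a) \<Rightarrow> bool" where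
  "vertex_quasi_geodesic E V K C n x \<longleftrightarrow>
     (\<forall>i\<le>n. x i \<in> V) \<and>
     (\<forall>j\<le>n. \<forall>i\<le>j.
        1 / K * (real j - real i) - C \<le> real (vertex_distance E (x i) (x j)) \<and>
        real (vertex_distance E (x i) (x j)) \<le> K * (real j - real i) + C)"

definition morse_radius ::
    "('a \<times> 'a) set \<Rightarrow> 'a set \<Rightarrow> 'a set \<Rightarrow> real \<Rightarrow> real \<Rightarrow> nat \<Rightarrow> bool" where
  "morse_radius E V A K C M \<longleftrightarrow>
     (\<forall>n x. vertex_quasi_geodesic E V K C n x \<and> x 0 \<in> A \<and> x n \<in> A \<longrightarrow>
        (\<forall>i\<le>n. \<exists>a\<in>A. vertex_distance E (x i) a \<le> M))"

definition vertex_morse :: "('a \<times> 'a) set \<Rightarrow> 'a set \<Rightarrow> 'a set \<Rightarrow> bool" where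
  "vertex_morse E V A \<longleftrightarrow>
     A \<subseteq> V \<and> (\<forall>K\<ge>1. \<forall>C\<ge>0. \<exists>M. morse_radius E V A K C M)"

definition set_nbhd :: "('a \<times> 'a) set \<Rightarrow> 'a set \<Rightarrow> 'a set \<Rightarrow> nat \<Rightarrow> 'a set" where
  "set_nbhd E V A h = {u \<in> V. \<exists>a\<in>A. vertex_distance E u a \<le> h}"

lemma vertex_quasi_geodesic_mono:
  assumes "vertex_quasi_geodesic E V K C n x" "1 \<le> K" "K \<le> K'" "C \<le> C'"
  shows "vertex_quasi_geodesic E V K' C' n x"
  unfolding vertex_quasi_geodesic_def
proof (intro conjI allI impI)
  show "x i \<in> V" if "i \<le> n" for i
    using assms that by (simp add: vertex_quasi_geodesic_def)
  fix i j assume ij: "j \<le> n" "i \<le> j"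
  have "1 / K' * (real j - real i) \<le> 1 / K * (real j - real i)"
    using assms ij by (intro mult_right_mono) (auto simp: frac_le)
  then show "1 / K' * (real j - real i) - C' \<le> real (vertex_distance E (x i) (x j))"
    using assms ij by (fastforce simp: vertex_quasi_geodesic_def)
  have "K * (real j - real i) \<le> K' * (real j - real i)"
    using assms ij by (intro mult_right_mono) auto
  then show "real (vertex_distance E (x i) (x j)) \<le> K' * (real j - real i) + C'"
    using assms ij by (fastforce simp: vertex_quasi_geodesic_def)
qed

lemma morse_radius_mono:
  assumes "morse_radius E V A K' C' M" "1 \<le> K" "K \<le> K'" "C \<le> C'" "M \<le> M'"
  shows "morse_radius E V A K C M'"
  using assms vertex_quasi_geodesic_mono[OF _ assms(2-4)]
  unfolding morse_radius_def by (meson le_trans)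

context connected_graph
begin

lemma nearby_vertex:
  assumes "p \<in> pts"
  obtains u where "u \<in> coord_supp p" "u \<in> V" "mdist (graph_metric V E) p (vertex_point u) \<le> 1"
proof -
  obtain u where u: "u \<in> coord_supp p" "u \<in> V" using supp_facts[OF assms] by blast
  have vu: "vertex_point u \<in> pts" using u by (auto simp: graph_points_def)
  have "graph_distance E p (vertex_point u) \<le> 1"
    using dist_upper[OF assms vu u(1), of u] coord_bounds[OF assms, of u]
      fun_cong[OF vertex_point_def[of u], of u] by simp
  then show thesis using that u mdist_graph[OF assms vu] by simp
qed

text \<open>
  The vertex is taken from the support so that a vertex point is rounded to itself: the maps built
  from \<open>nearest_vertex\<close> must fix the end points of paths and the elements of subgroups.
\<close>

definition nearest_vertex :: "('a \<Rightarrow> real) \<Rightarrow> 'a" where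
  "nearest_vertex p =
     (SOME u. u \<in> coord_supp p \<and> u \<in> V \<and> mdist (graph_metric V E) p (vertex_point u) \<le> 1)"

lemma nearest_vertex:
  assumes "p \<in> pts"
  shows "nearest_vertex p \<in> coord_supp p" "nearest_vertex p \<in> V"
    "mdist (graph_metric V E) p (vertex_point (nearest_vertex p)) \<le> 1"
proof -
  have "\<exists>u. u \<in> coord_supp p \<and> u \<in> V \<and> mdist (graph_metric V E) p (vertex_point u) \<le> 1"
    using nearby_vertex[OF assms] by metis
  from someI_ex[OF this, folded nearest_vertex_def]
  show "nearest_vertex p \<in> coord_supp p" "nearest_vertex p \<in> V"
    "mdist (graph_metric V E) p (vertex_point (nearest_vertex p)) \<le> 1" by auto
qed

lemma vertex_in_pts: "u \<in> V \<Longrightarrow> vertex_point u \<in> pts"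
  by (auto simp: graph_points_def)

lemma nearest_vertex_vertex: "u \<in> V \<Longrightarrow> nearest_vertex (vertex_point u) = u"
  using nearest_vertex(1)[OF vertex_in_pts] by auto

lemma nearest_vertex_distance:
  assumes "p \<in> pts" "q \<in> pts"
  shows "\<bar>real (gd (nearest_vertex p) (nearest_vertex q)) - mdist (graph_metric V E) p q\<bar> \<le> 2"
proof -
  let ?d = "mdist (graph_metric V E)"
  let ?p = "vertex_point (nearest_vertex p)" and ?q = "vertex_point (nearest_vertex q)"
  have pq: "p \<in> mspace (graph_metric V E)" "q \<in> mspace (graph_metric V E)"
    "?p \<in> mspace (graph_metric V E)" "?q \<in> mspace (graph_metric V E)"
    using assms nearest_vertex(2) vertex_in_pts by auto
  have "?d ?p ?q = gd (nearest_vertex p) (nearest_vertex q)"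
    using mdist_vertices nearest_vertex(2) assms by blast
  moreover have "?d p ?p \<le> 1" "?d q ?q \<le> 1" using nearest_vertex(3) assms by auto
  moreover have "?d p q \<le> ?d p ?p + ?d ?p q" "?d ?p q \<le> ?d ?p ?q + ?d ?q q"
    "?d ?p ?q \<le> ?d ?p p + ?d p ?q" "?d p ?q \<le> ?d p q + ?d q ?q"
    using pq by (auto intro!: mdist_triangle)
  moreover have "?d ?p p = ?d p ?p" "?d ?q q = ?d q ?q"
    by (simp_all add: mdist_commute)
  ultimately show ?thesis by linarith
qed

text \<open>
  A sequence of vertices becomes a path by rounding the parameter down. Since quasi-geodesics may
  be discontinuous, the only cost is an additive constant: rounding moves a
  parameter by less than 1, hence shifts the upper bound by at most \<open>K\<close> and the lower one by at
  most \<open>1 / K \<le> K\<close>.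
\<close>

lemma vertex_morse_if_morse_subset:
  assumes morse: "morse_subset (graph_metric V E) (vertex_point ` A)" and A: "A \<subseteq> V"
  shows "vertex_morse E V A"
  unfolding vertex_morse_def
proof (intro conjI A allI impI)
  fix K C :: real assume K: "1 \<le> K" and C: "0 \<le> C"
  have "0 \<le> C + K" using K C by simp
  from morse[unfolded morse_subset_def, THEN conjunct2, THEN spec[of _ K], THEN mp, OF K,
      THEN spec[of _ "C + K"], THEN mp, OF this]
  obtain M where M: "\<forall>a b c. a \<le> b \<and>
      quasi_geodesic (graph_metric V E) K (C + K) {a..b} c \<and>
      c a \<in> vertex_point ` A \<and> c b \<in> vertex_point ` A \<longrightarrow>
      (\<forall>t\<in>{a..b}. \<exists>p\<in>vertex_point ` A. mdist (graph_metric V E) (c t) p \<le> M)" ..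
  have "morse_radius E V A K C (nat \<lfloor>M\<rfloor>)"
    unfolding morse_radius_def
  proof (intro allI impI)
    fix n x i assume "vertex_quasi_geodesic E V K C n x \<and> x 0 \<in> A \<and> x n \<in> A" and i: "i \<le> n"
    then have x: "vertex_quasi_geodesic E V K C n x" and ends: "x 0 \<in> A" "x n \<in> A" by auto
    define c where "c t = vertex_point (x (nat \<lfloor>t\<rfloor>))" for t :: real
    have xV: "x k \<in> V" if "k \<le> n" for k using x that by (simp add: vertex_quasi_geodesic_def)
    have dist_c: "1 / K * (t - s) - (C + K) \<le> mdist (graph_metric V E) (c s) (c t) \<and>
        mdist (graph_metric V E) (c s) (c t) \<le> K * (t - s) + (C + K)"
      if st: "s \<le> t" "0 \<le> s" "t \<le> real n" for s t
    proof -
      define j k where "j = nat \<lfloor>s\<rfloor>" and "k = nat \<lfloor>t\<rfloor>"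
      have jk: "real j \<le> s" "s < real j + 1" "real k \<le> t" "t < real k + 1"
        using st unfolding j_def k_def by linarith+
      then have "real j < real k + 1" "real k < real n + 1" using st by linarith+
      then have jk': "j \<le> k" "k \<le> n" by linarith+
      note jk = jk jk'
      have eq: "mdist (graph_metric V E) (c s) (c t) = gd (x j) (x k)"
        unfolding c_def j_def[symmetric] k_def[symmetric] using jk xV by (simp add: mdist_vertices)
      have "1 / K * (t - s) \<le> 1 / K * ((real k - real j) + 1)"
        using jk K by (intro mult_left_mono) auto
      also have "\<dots> \<le> 1 / K * (real k - real j) + K"
      proof -
        have "1 / K \<le> 1" using K by simp
        then have "1 / K \<le> K" using K by linarith
        then show ?thesis by (simp add: distrib_left)
      qed
      finally have lower: "1 / K * (t - s) \<le> 1 / K * (real k - real j) + K" .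
      have "K * (real k - real j) \<le> K * ((t - s) + 1)"
        using jk K by (intro mult_left_mono) auto
      then have upper: "K * (real k - real j) \<le> K * (t - s) + K" by (simp add: distrib_left)
      have "1 / K * (real k - real j) - C \<le> real (gd (x j) (x k))"
        "real (gd (x j) (x k)) \<le> K * (real k - real j) + C"
        using x jk unfolding vertex_quasi_geodesic_def by blast+
      then show ?thesis unfolding eq using lower upper by linarith
    qed
    have "quasi_geodesic (graph_metric V E) K (C + K) {0..real n} c"
      unfolding quasi_geodesic_def qi_embedding_def
    proof (intro conjI ballI)
      show "is_interval {0..real n}" by (rule is_interval_cc)
      show "c \<in> mspace (submetric euclidean_metric {0..real n}) \<rightarrow> mspace (graph_metric V E)"
      proof
        fix t assume "t \<in> mspace (submetric euclidean_metric {0..real n})"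
        then have "nat \<lfloor>t\<rfloor> \<le> n" by auto linarith
        then show "c t \<in> mspace (graph_metric V E)"
          using xV by (auto simp: c_def intro: vertex_in_pts)
      qed
      fix s t :: real
      assume "s \<in> mspace (submetric euclidean_metric {0..real n})"
        "t \<in> mspace (submetric euclidean_metric {0..real n})"
      then have st: "0 \<le> s" "s \<le> real n" "0 \<le> t" "t \<le> real n" by auto
      have "1 / K * mdist (submetric euclidean_metric {0..real n}) s t - (C + K)
            \<le> mdist (graph_metric V E) (c s) (c t) \<and>
          mdist (graph_metric V E) (c s) (c t)
            \<le> K * mdist (submetric euclidean_metric {0..real n}) s t + (C + K)"
      proof (cases "s \<le> t")
        case True
        then show ?thesis using dist_c[of s t] st by (simp add: dist_real_def)
      next
        case False
        then show ?thesis using dist_c[of t s] st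
          by (simp add: dist_real_def mdist_commute)
      qed
      then show "1 / K * mdist (submetric euclidean_metric {0..real n}) s t - (C + K)
            \<le> mdist (graph_metric V E) (c s) (c t)"
        "mdist (graph_metric V E) (c s) (c t)
            \<le> K * mdist (submetric euclidean_metric {0..real n}) s t + (C + K)" by auto
    qed
    from M[THEN spec[of _ 0], THEN spec[of _ "real n"], THEN spec[of _ c]] this ends have "\<forall>t\<in>{0..real n}.
        \<exists>p\<in>vertex_point ` A. mdist (graph_metric V E) (c t) p \<le> M"
      by (simp add: c_def)
    moreover have "real i \<in> {0..real n}" using i by simp
    ultimately obtain a where a: "a \<in> A"
      "mdist (graph_metric V E) (c (real i)) (vertex_point a) \<le> M" by blast
    have "real (gd (x i) a) \<le> M"
      using a A xV[OF i] mdist_vertices[of "x i" a] by (auto simp: c_def)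
    then show "\<exists>a\<in>A. gd (x i) a \<le> nat \<lfloor>M\<rfloor>" using a by (intro bexI[of _ a]) linarith
  qed
  then show "\<exists>M. morse_radius E V A K C M" by blast
qed

text \<open>
  Conversely a quasi-geodesic is sampled at integer times, and the samples are rounded to vertices.
  Sampling at \<open>b\<close> instead of the next integer time costs at most \<open>1 / K \<le> 1\<close> in the lower bound,
  and rounding at most 2, whence the additive constant \<open>C + 3\<close>. A point between two sample times is
  within \<open>K + C\<close> of a sample.
\<close>

lemma morse_subset_if_vertex_morse:
  assumes morse: "vertex_morse E V A"
  shows "morse_subset (graph_metric V E) (vertex_point ` A)"
  unfolding morse_subset_def
proof (intro conjI allI impI)
  have A: "A \<subseteq> V" using morse by (simp add: vertex_morse_def)
  show "vertex_point ` A \<subseteq> mspace (graph_metric V E)" using A vertex_in_pts by auto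
  fix K C :: real assume K: "1 \<le> K" and C: "0 \<le> C"
  have "0 \<le> C + 3" using C by simp
  then obtain M where M: "morse_radius E V A K (C + 3) M"
    using morse K unfolding vertex_morse_def by blast
  let ?d = "mdist (graph_metric V E)"
  show "\<exists>M. \<forall>a b c. a \<le> b \<and> quasi_geodesic (graph_metric V E) K C {a..b} c \<and>
      c a \<in> vertex_point ` A \<and> c b \<in> vertex_point ` A \<longrightarrow>
      (\<forall>t\<in>{a..b}. \<exists>p\<in>vertex_point ` A. ?d (c t) p \<le> M)"
  proof (intro exI[of _ "K + C + 1 + real M"] allI impI ballI)
    fix a b c t assume "a \<le> b \<and> quasi_geodesic (graph_metric V E) K C {a..b} c \<and>
      c a \<in> vertex_point ` A \<and> c b \<in> vertex_point ` A" and t: "t \<in> {a..b}"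
    then have ab: "a \<le> b" and qg: "quasi_geodesic (graph_metric V E) K C {a..b} c"
      and ends: "c a \<in> vertex_point ` A" "c b \<in> vertex_point ` A" by auto
    have c_pts: "c s \<in> pts" if "s \<in> {a..b}" for s
    proof -
      have "c \<in> {a..b} \<rightarrow> pts" using qg by (simp add: quasi_geodesic_def qi_embedding_def)
      then show ?thesis using that by (rule funcset_mem)
    qed
    have c_dist: "1 / K * (s' - s) - C \<le> ?d (c s) (c s') \<and> ?d (c s) (c s') \<le> K * (s' - s) + C"
      if "s \<in> {a..b}" "s' \<in> {a..b}" "s \<le> s'" for s s'
    proof -
      have "\<bar>s - s'\<bar> = s' - s" using that by simp
      moreover have "1 / K * dist s s' - C \<le> ?d (c s) (c s') \<and>
          ?d (c s) (c s') \<le> K * dist s s' + C"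
        using qg that unfolding quasi_geodesic_def qi_embedding_def by auto
      ultimately show ?thesis by (simp only: dist_real_def)
    qed
    define n where "n = nat \<lfloor>b - a\<rfloor> + 1"
    \<comment> \<open>The last step, from \<open>a + (n - 1)\<close> to \<open>b\<close>, may be shorter than 1.\<close>
    define \<tau> where "\<tau> i = min (a + real i) b" for i
    define x where "x i = nearest_vertex (c (\<tau> i))" for i
    have n: "b \<le> a + real n" "a + real n \<le> b + 1" using ab unfolding n_def by linarith+
    have \<tau>_in: "\<tau> i \<in> {a..b}" for i using ab by (auto simp: \<tau>_def)
    have \<tau>: "\<tau> i \<le> \<tau> j" "\<tau> j - \<tau> i \<le> real j - real i" "real j - real i - 1 \<le> \<tau> j - \<tau> i"
      if "i \<le> j" "j \<le> n" for i j
    proof -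
      have "real i \<le> real j" "real j \<le> real n" using that by simp_all
      then show "\<tau> i \<le> \<tau> j" "\<tau> j - \<tau> i \<le> real j - real i" "real j - real i - 1 \<le> \<tau> j - \<tau> i"
        using n unfolding \<tau>_def min_def by (smt (verit))+
    qed
    have "vertex_quasi_geodesic E V K (C + 3) n x"
      unfolding vertex_quasi_geodesic_def
    proof (intro conjI allI impI)
      show "x i \<in> V" if "i \<le> n" for i
        using nearest_vertex(2) c_pts \<tau>_in by (simp add: x_def)
      fix i j assume ij: "j \<le> n" "i \<le> j"
      have "1 / K * (real j - real i) \<le> 1 / K * ((\<tau> j - \<tau> i) + 1)"
        using \<tau>[of i j] ij K by (intro mult_left_mono) auto
      also have "\<dots> \<le> 1 / K * (\<tau> j - \<tau> i) + 1"
      proof -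
        have "1 / K \<le> 1" using K by simp
        then show ?thesis by (simp add: distrib_left)
      qed
      finally have lower: "1 / K * (real j - real i) \<le> 1 / K * (\<tau> j - \<tau> i) + 1" .
      have upper: "K * (\<tau> j - \<tau> i) \<le> K * (real j - real i)"
        using \<tau>[of i j] ij K by (intro mult_left_mono) auto
      note near = nearest_vertex_distance[OF c_pts[OF \<tau>_in[of i]] c_pts[OF \<tau>_in[of j]],
          folded x_def]
      note c_dist[OF \<tau>_in \<tau>_in \<tau>(1)[OF ij(2,1)]]
      then show "1 / K * (real j - real i) - (C + 3) \<le> real (gd (x i) (x j))"
        "real (gd (x i) (x j)) \<le> K * (real j - real i) + (C + 3)"
        using lower upper near by linarith+
    qed
    moreover have "x 0 \<in> A" "x n \<in> A"
    proof -
      have "\<tau> 0 = a" "\<tau> n = b" using ab n by (auto simp: \<tau>_def)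
      then show "x 0 \<in> A" "x n \<in> A"
        using ends A nearest_vertex_vertex by (auto simp: x_def)
    qed
    ultimately have near_A: "\<forall>i\<le>n. \<exists>h\<in>A. gd (x i) h \<le> M"
      using M unfolding morse_radius_def by blast
    define i where "i = nat \<lfloor>t - a\<rfloor>"
    have "real i \<le> t - a" "t - a < real i + 1" using t unfolding i_def by auto
    then have i: "i \<le> n" "\<tau> i \<le> t" "t - \<tau> i \<le> 1"
      using t n unfolding \<tau>_def by auto
    obtain h where h: "h \<in> A" "gd (x i) h \<le> M" using near_A i by blast
    have ms: "c (\<tau> i) \<in> mspace (graph_metric V E)" "c t \<in> mspace (graph_metric V E)"
      "vertex_point (x i) \<in> mspace (graph_metric V E)"
      "vertex_point h \<in> mspace (graph_metric V E)"
      using c_pts \<tau>_in t h A nearest_vertex(2) by (auto simp: x_def intro!: vertex_in_pts)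
    have "?d (c t) (c (\<tau> i)) \<le> K * (t - \<tau> i) + C"
      using c_dist[OF \<tau>_in t i(2)] by (simp add: mdist_commute)
    also have "\<dots> \<le> K + C"
      using i K mult_left_mono[of "t - \<tau> i" 1 K] by simp
    finally have "?d (c t) (c (\<tau> i)) \<le> K + C" .
    moreover have "?d (c (\<tau> i)) (vertex_point (x i)) \<le> 1"
      using nearest_vertex(3)[OF c_pts[OF \<tau>_in[of i]]] by (simp add: x_def)
    moreover have "?d (vertex_point (x i)) (vertex_point h) \<le> real M"
      using h A nearest_vertex(2)[OF c_pts[OF \<tau>_in[of i]]] mdist_vertices[of "x i" h]
      by (auto simp: x_def)
    moreover have "?d (c t) (vertex_point h) \<le> ?d (c t) (c (\<tau> i)) + ?d (c (\<tau> i)) (vertex_point h)"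
      "?d (c (\<tau> i)) (vertex_point h)
        \<le> ?d (c (\<tau> i)) (vertex_point (x i)) + ?d (vertex_point (x i)) (vertex_point h)"
      using ms by (auto intro!: mdist_triangle)
    ultimately have "?d (c t) (vertex_point h) \<le> K + C + 1 + real M" by linarith
    then show "\<exists>p\<in>vertex_point ` A. ?d (c t) p \<le> K + C + 1 + real M" using h by blast
  qed
qed

end


section \<open>Least-cost walks\<close>

context connected_graph
begin

text \<open>
  The source is required to be a vertex, so that a walk of length 0 stays in the graph as well.
\<close>

definition walk :: "'a \<Rightarrow> 'a \<Rightarrow> nat \<Rightarrow> (nat \<Rightarrow> 'a) \<Rightarrow> bool" where
  "walk u v n x \<longleftrightarrow> u \<in> V \<and> x 0 = u \<and> x n = v \<and> (\<forall>i<n. (x i, x (Suc i)) \<in> E)"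

text \<open>
  The last vertex of a walk is not counted, so that costs add up when walks are concatenated. With
  all weights equal to 1 this is the graph distance. As the weight is charged on leaving, \<open>wdist\<close>
  need not be symmetric.
\<close>

definition wdist :: "('a \<Rightarrow> nat) \<Rightarrow> 'a \<Rightarrow> 'a \<Rightarrow> nat" where
  "wdist w u v = (LEAST c. \<exists>n x. walk u v n x \<and> c = (\<Sum>k<n. w (x k)))"

definition least_cost_walk :: "('a \<Rightarrow> nat) \<Rightarrow> 'a \<Rightarrow> 'a \<Rightarrow> nat \<Rightarrow> (nat \<Rightarrow> 'a) \<Rightarrow> bool" where
  "least_cost_walk w u v n x \<longleftrightarrow> walk u v n x \<and> (\<Sum>k<n. w (x k)) = wdist w u v"

lemma walk_vertex:
  assumes "walk u v n x" "i \<le> n"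
  shows "x i \<in> V"
proof (cases i)
  case (Suc k)
  then have "(x k, x i) \<in> E" using assms by (simp add: walk_def)
  then show ?thesis using edges by blast
qed (use assms in \<open>simp add: walk_def\<close>)

lemma walk_segment:
  assumes "walk u v n x" "i \<le> j" "j \<le> n"
  shows "walk (x i) (x j) (j - i) (\<lambda>k. x (i + k))"
  using assms walk_vertex[of u v n x i] by (auto simp: walk_def)

lemma gd_le_walk: "walk u v n x \<Longrightarrow> gd u v \<le> n"
  by (intro gd_le) (auto simp: walk_def relpow_fun_conv)

lemma gd_walk_le:
  assumes "walk u v n x" "i \<le> j" "j \<le> n"
  shows "gd (x i) (x j) \<le> j - i"
  using gd_le_walk[OF walk_segment[OF assms]] .

lemma geodesic_walk:
  assumes "u \<in> V" "v \<in> V"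
  obtains x where "walk u v (gd u v) x"
  using gd_walk[OF assms] assms unfolding relpow_fun_conv walk_def by auto

lemma geodesic_walk_distances:
  assumes "walk u v (gd u v) x" "v \<in> V" "i \<le> gd u v"
  shows "gd u (x i) = i" "gd (x i) v = gd u v - i"
proof -
  have V: "u \<in> V" "x i \<in> V" "x 0 = u" "x (gd u v) = v"
    using assms walk_vertex by (auto simp: walk_def)
  have "gd u (x i) \<le> i" "gd (x i) v \<le> gd u v - i"
    using gd_walk_le[OF assms(1), of 0 i] gd_walk_le[OF assms(1), of i "gd u v"] V assms(3) by auto
  moreover have "gd u v \<le> gd u (x i) + gd (x i) v" using gd_triangle V assms(2) by blast
  ultimately show "gd u (x i) = i" "gd (x i) v = gd u v - i" using assms(3) by linarith+
qed

lemma walk_append: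
  assumes "walk u v m x" "walk v z n y"
  defines "p \<equiv> \<lambda>k. if k < m then x k else y (k - m)"
  shows "walk u z (m + n) p" "(\<Sum>k<m + n. w (p k)) = (\<Sum>k<m. w (x k)) + (\<Sum>k<n. w (y k))"
proof -
  have "(p i, p (Suc i)) \<in> E" if "i < m + n" for i
  proof -
    consider "Suc i < m" | "Suc i = m" | "m \<le> i" by linarith
    then show ?thesis
    proof cases
      case 2
      then have "p (Suc i) = x (Suc i)" using assms(1,2) by (simp add: p_def walk_def)
      moreover have "(x i, x (Suc i)) \<in> E" using 2 assms(1) unfolding walk_def by blast
      ultimately show ?thesis using 2 by (simp add: p_def)
    next
      case 3
      then show ?thesis using that assms(2) by (simp add: p_def walk_def Suc_diff_le)
    qed (use assms(1) in \<open>simp add: p_def walk_def\<close>)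
  qed
  moreover have "p 0 = u" "p (m + n) = z" using assms(1,2) by (auto simp: p_def walk_def)
  ultimately show "walk u z (m + n) p" using assms(1) by (simp add: walk_def)
  have "(\<Sum>k<m + n. w (p k)) = (\<Sum>k<m. w (p k)) + (\<Sum>k<n. w (p (m + k)))"
    using sum.atLeastLessThan_concat[of 0 m "m + n" "\<lambda>k. w (p k)"]
      sum.shift_bounds_nat_ivl[of "\<lambda>k. w (p k)" 0 m n]
    by (simp add: lessThan_atLeast0 add.commute)
  then show "(\<Sum>k<m + n. w (p k)) = (\<Sum>k<m. w (x k)) + (\<Sum>k<n. w (y k))"
    by (simp add: p_def)
qed

lemma wdist_le: "walk u v n x \<Longrightarrow> wdist w u v \<le> (\<Sum>k<n. w (x k))"
  unfolding wdist_def by (rule Least_le) blast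

lemma least_cost_walk_exists:
  assumes "u \<in> V" "v \<in> V"
  obtains n x where "least_cost_walk w u v n x"
proof -
  obtain x where "walk u v (gd u v) x" using geodesic_walk[OF assms] .
  then have "\<exists>c n x. walk u v n x \<and> c = (\<Sum>k<n. w (x k))" by blast
  from LeastI_ex[OF this, folded wdist_def] that show thesis
    unfolding least_cost_walk_def by metis
qed

lemma wdist_triangle:
  assumes "u \<in> V" "v \<in> V" "z \<in> V"
  shows "wdist w u z \<le> wdist w u v + wdist w v z"
proof -
  obtain m x where x: "least_cost_walk w u v m x" using least_cost_walk_exists[OF assms(1,2)] .
  obtain n y where y: "least_cost_walk w v z n y" using least_cost_walk_exists[OF assms(2,3)] .
  show ?thesis
    using wdist_le[OF walk_append(1)[of u v m x z n y], of w] walk_append(2)[of u v m x z n y w] x y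
    by (simp add: least_cost_walk_def)
qed

lemma wdist_le_gd:
  assumes "u \<in> V" "v \<in> V" and le: "\<And>z. w z \<le> L"
  shows "wdist w u v \<le> L * gd u v"
proof -
  obtain x where x: "walk u v (gd u v) x" using geodesic_walk[OF assms(1,2)] .
  have "wdist w u v \<le> (\<Sum>k<gd u v. w (x k))" using wdist_le[OF x] .
  also have "\<dots> \<le> (\<Sum>k<gd u v. L)" by (intro sum_mono le)
  finally show ?thesis by (simp add: mult.commute)
qed

text \<open>
  Otherwise a cheaper walk between the two intermediate vertices could be spliced in.
\<close>

lemma least_cost_segment:
  assumes x: "least_cost_walk w u v n x" and ij: "i \<le> j" "j \<le> n"
  shows "(\<Sum>k=i..<j. w (x k)) \<le> wdist w (x i) (x j)"
proof -
  have wx: "walk u v n x" and opt: "(\<Sum>k<n. w (x k)) = wdist w u v"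
    using x by (auto simp: least_cost_walk_def)
  have ends: "x 0 = u" "x n = v" using wx by (auto simp: walk_def)
  have V: "u \<in> V" "v \<in> V" "x i \<in> V" "x j \<in> V"
    using walk_vertex[OF wx] ij ends by (metis le_trans order_refl zero_le)+
  have "wdist w u (x i) \<le> (\<Sum>k<i. w (x k))"
    using wdist_le[OF walk_segment[OF wx, of 0 i], of w] ij ends by simp
  moreover have "wdist w (x j) v \<le> (\<Sum>k<n - j. w (x (j + k)))"
    using wdist_le[OF walk_segment[OF wx, of j n], of w] ij ends by simp
  moreover have "(\<Sum>k<n - j. w (x (j + k))) = (\<Sum>k=j..<n. w (x k))"
    using sum.shift_bounds_nat_ivl[of "\<lambda>k. w (x k)" 0 j "n - j"] ij
    by (simp add: lessThan_atLeast0 add.commute)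
  moreover have "wdist w u v \<le> wdist w u (x i) + (wdist w (x i) (x j) + wdist w (x j) v)"
    using wdist_triangle V by (meson add_left_mono le_trans)
  moreover have "(\<Sum>k<n. w (x k))
      = (\<Sum>k<i. w (x k)) + (\<Sum>k=i..<j. w (x k)) + (\<Sum>k=j..<n. w (x k))"
    using ij by (simp add: lessThan_atLeast0 sum.atLeastLessThan_concat)
  ultimately show ?thesis using opt by linarith
qed

text \<open>
  The source of all quasi-geodesics used below. A segment of a least-cost walk costs at least its
  length, because weights are at least 1, and no more than a geodesic between its ends, which costs
  at most \<open>L\<close> times their distance. So every choice of weights in \<open>{1..L}\<close> yields
  \<open>(L, 0)\<close>-quasi-geodesics, with constants independent of where the heavy vertices are.
\<close>

lemma least_cost_walk_quasi_geodesic: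
  assumes x: "least_cost_walk w u v n x" and w: "\<And>z. 1 \<le> w z" "\<And>z. w z \<le> L"
  shows "vertex_quasi_geodesic E V (real L) 0 n x"
  unfolding vertex_quasi_geodesic_def
proof (intro conjI allI impI)
  have wx: "walk u v n x" using x by (simp add: least_cost_walk_def)
  show "x i \<in> V" if "i \<le> n" for i using walk_vertex[OF wx that] .
  fix i j assume ij: "j \<le> n" "i \<le> j"
  have L: "1 \<le> L" using w le_trans by blast
  have "j - i = (\<Sum>k=i..<j. 1)" by simp
  also have "\<dots> \<le> (\<Sum>k=i..<j. w (x k))" by (intro sum_mono w)
  also have "\<dots> \<le> wdist w (x i) (x j)" using least_cost_segment[OF x ij(2,1)] .
  also have "\<dots> \<le> L * gd (x i) (x j)"
    using wdist_le_gd w(2) walk_vertex[OF wx] ij by simp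
  finally have "j - i \<le> L * gd (x i) (x j)" .
  then have "real (j - i) \<le> real L * real (gd (x i) (x j))"
    by (metis of_nat_le_iff of_nat_mult)
  then show "1 / real L * (real j - real i) - 0 \<le> real (gd (x i) (x j))"
    using L ij by (simp add: field_simps of_nat_diff)
  have "real (gd (x i) (x j)) \<le> 1 * (real j - real i)"
    using gd_walk_le[OF wx ij(2,1)] ij by (simp flip: of_nat_diff)
  also have "\<dots> \<le> real L * (real j - real i)" using L ij by (intro mult_right_mono) auto
  finally show "real (gd (x i) (x j)) \<le> real L * (real j - real i) + 0" by simp
qed

lemma least_cost_walk_near:
  assumes M: "morse_radius E V A (real L) 0 M" and w: "\<And>z. 1 \<le> w z" "\<And>z. w z \<le> L"
    and x: "least_cost_walk w u v n x" and uv: "u \<in> A" "v \<in> A" and A: "A \<subseteq> V" and i: "i \<le> n"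
  shows "x i \<in> set_nbhd E V A M"
proof -
  have wx: "walk u v n x" using x by (simp add: least_cost_walk_def)
  have "x 0 \<in> A" "x n \<in> A" using wx uv by (auto simp: walk_def)
  then have "\<exists>a\<in>A. gd (x i) a \<le> M"
    using M least_cost_walk_quasi_geodesic[OF x w] i unfolding morse_radius_def by blast
  then show ?thesis using walk_vertex[OF wx i] by (auto simp: set_nbhd_def)
qed

lemma geodesic_near:
  assumes M: "morse_radius E V A 1 0 M" and uv: "u \<in> A" "v \<in> A" and A: "A \<subseteq> V"
    and x: "walk u v (gd u v) x" and i: "i \<le> gd u v"
  shows "x i \<in> set_nbhd E V A M"
proof (rule least_cost_walk_near[where w = "\<lambda>_. 1" and L = 1])
  show "least_cost_walk (\<lambda>_. 1) u v (gd u v) x"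
  proof -
    obtain n y where y: "least_cost_walk (\<lambda>_. 1) u v n y"
      using least_cost_walk_exists uv A by (metis subsetD)
    then have "walk u v n y" "n = wdist (\<lambda>_. 1) u v" by (auto simp: least_cost_walk_def)
    moreover from this have "gd u v \<le> n" by (intro gd_le_walk)
    ultimately have "gd u v \<le> wdist (\<lambda>_. 1) u v" by simp
    then show ?thesis using x wdist_le[OF x, of "\<lambda>_. 1"] by (simp add: least_cost_walk_def)
  qed
qed (use assms in auto)


section \<open>Nearby Morse subsets\<close>

lemma wdist_along:
  assumes M: "morse_radius E V A 1 0 M" and uv: "u \<in> A" "v \<in> A" and A: "A \<subseteq> V" and h: "M \<le> h"
    and w: "\<And>z. z \<in> set_nbhd E V A h \<Longrightarrow> w z = 1"
  shows "wdist w u v \<le> gd u v"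
proof -
  have "u \<in> V" "v \<in> V" using uv A by auto
  then obtain x where x: "walk u v (gd u v) x" using geodesic_walk by blast
  have "w (x k) = 1" if "k < gd u v" for k
    using geodesic_near[OF M uv A x, of k] that h w by (force simp: set_nbhd_def)
  then show ?thesis using wdist_le[OF x, of w] by simp
qed

text \<open>
  Make the vertices far from \<open>A\<close> twice as expensive as those near \<open>A\<close>, and join \<open>b\<close> to \<open>b'\<close> at
  least cost. The walk stays near \<open>B\<close>; if \<open>B\<close> is far from \<open>A\<close> it pays 2 at each step, hence at
  least \<open>2 * gd b b'\<close>. The detour from \<open>b\<close> to \<open>a\<close>, along a geodesic near \<open>A\<close> to \<open>a'\<close>, and on to
  \<open>b'\<close> costs at most \<open>gd b b' + 6 * r\<close>, which is less. The point is that the bound obtained,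
  \<open>2 * M\<close>, does not depend on \<open>r\<close>.
\<close>

lemma close_if_fellow_travelling:
  assumes MA: "morse_radius E V A 1 0 M" and MB: "morse_radius E V B 2 0 M"
    and AB: "A \<subseteq> V" "B \<subseteq> V" and ab: "a \<in> A" "a' \<in> A" "b \<in> B" "b' \<in> B"
    and r: "gd a b \<le> r" "gd a' b' \<le> r" and far: "6 * r < gd b b'"
  shows "\<exists>a\<in>A. \<exists>b\<in>B. gd a b \<le> 2 * M"
proof (rule ccontr)
  assume apart: "\<not> ?thesis"
  define w where "w z = (if z \<in> set_nbhd E V A M then 1 else 2 :: nat)" for z
  have w: "1 \<le> w z" "w z \<le> 2" for z by (auto simp: w_def)
  have V: "a \<in> V" "a' \<in> V" "b \<in> V" "b' \<in> V" using AB ab by auto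
  obtain n x where x: "least_cost_walk w b b' n x" using least_cost_walk_exists V by blast
  have wx: "walk b b' n x" using x by (simp add: least_cost_walk_def)
  have "w (x k) = 2" if "k < n" for k
  proof -
    have "x k \<in> set_nbhd E V B M"
      using least_cost_walk_near[of B 2 M w b b' n x k] MB w x ab AB that by simp
    then obtain y where y: "y \<in> B" "gd (x k) y \<le> M" "x k \<in> V" by (auto simp: set_nbhd_def)
    have "x k \<notin> set_nbhd E V A M"
    proof
      assume "x k \<in> set_nbhd E V A M"
      then obtain z where z: "z \<in> A" "gd (x k) z \<le> M" by (auto simp: set_nbhd_def)
      have zV: "z \<in> V" "y \<in> V" using z y AB by auto
      have "gd z y \<le> gd z (x k) + gd (x k) y" using gd_triangle zV y by blast
      then have "gd z y \<le> 2 * M" using z y gd_sym[of z "x k"] zV by simp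
      then show False using apart z y by blast
    qed
    then show ?thesis by (simp add: w_def)
  qed
  then have "2 * n = wdist w b b'" using x by (simp add: least_cost_walk_def)
  also have "\<dots> \<le> wdist w b a + (wdist w a a' + wdist w a' b')"
    using wdist_triangle V by (meson add_left_mono le_trans)
  also have "\<dots> \<le> 2 * gd b a + (gd a a' + 2 * gd a' b')"
    using wdist_le_gd[of b a w 2] wdist_le_gd[of a' b' w 2] V w(2)
      wdist_along[OF MA ab(1,2) AB(1) le_refl, of w] by (simp add: w_def)
  finally have "2 * n \<le> 4 * r + gd a a'" using r gd_sym[of a b] V by simp
  moreover have "gd a a' \<le> gd a b + (gd b b' + gd b' a')"
    using gd_triangle V by (meson add_left_mono le_trans)
  moreover have "gd b b' \<le> n" using gd_le_walk[OF wx] .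
  ultimately show False using far r gd_sym[of a' b'] V by linarith
qed

text \<open>
  From a point \<open>y\<close> of \<open>B\<close> one reaches a point \<open>e\<close> near both \<open>A\<close> and \<open>B\<close> in a number of steps that is
  linear in the distance from \<open>y\<close> to \<open>A\<close>, without coming near \<open>A\<close> earlier. Such a walk is the
  initial part, up to its first visit to the neighbourhood of \<open>A\<close>, of a least-cost walk from \<open>y\<close> to
  \<open>b\<close> for the same weights as above. It stays near \<open>B\<close>, and it is short because each of its steps
  costs 2, whereas going from \<open>y\<close> to \<open>x\<close> and then along \<open>A\<close> is an alternative.
\<close>

lemma walk_to_intersection:
  assumes MA: "morse_radius E V A 1 0 M" and MB: "morse_radius E V B 2 0 M"
    and AB: "A \<subseteq> V" "B \<subseteq> V" and h: "M \<le> h" "D \<le> h"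
    and ab: "a \<in> A" "b \<in> B" "gd a b \<le> D" and x: "x \<in> A" and y: "y \<in> B"
  obtains e m z where "walk y e m z" "m \<le> 3 * gd x y + 2 * D"
    "\<And>k. k < m \<Longrightarrow> z k \<notin> set_nbhd E V A h" "e \<in> set_nbhd E V A h" "e \<in> set_nbhd E V B M"
proof -
  define w where "w z = (if z \<in> set_nbhd E V A h then 1 else 2 :: nat)" for z
  have w: "1 \<le> w z" "w z \<le> 2" for z by (auto simp: w_def)
  have V: "a \<in> V" "b \<in> V" "x \<in> V" "y \<in> V" using AB ab x y by auto
  obtain n z where z: "least_cost_walk w y b n z" using least_cost_walk_exists V by blast
  have wz: "walk y b n z" using z by (simp add: least_cost_walk_def)
  have zn: "z n = b" "z 0 = y" using wz by (auto simp: walk_def)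
  have bA: "b \<in> set_nbhd E V A h"
    using ab V gd_sym[of a b] h by (auto simp: set_nbhd_def intro!: bexI[of _ a])
  define m where "m = (LEAST k. z k \<in> set_nbhd E V A h)"
  have zm: "z m \<in> set_nbhd E V A h" unfolding m_def using bA zn by (metis LeastI)
  have mn: "m \<le> n" unfolding m_def using bA zn by (metis Least_le)
  have before: "z k \<notin> set_nbhd E V A h" if "k < m" for k
    using that unfolding m_def by (rule not_less_Least)
  have zmV: "z m \<in> V" using walk_vertex[OF wz mn] .
  have "2 * m = (\<Sum>k<m. w (z k))" using before by (simp add: w_def)
  moreover have "gd (z m) b \<le> (\<Sum>k=m..<n. w (z k))"
  proof -
    have "gd (z m) b \<le> (\<Sum>k=m..<n. 1)" using gd_walk_le[OF wz mn] zn by simp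
    also have "\<dots> \<le> (\<Sum>k=m..<n. w (z k))" by (intro sum_mono w)
    finally show ?thesis .
  qed
  moreover have "(\<Sum>k<m. w (z k)) + (\<Sum>k=m..<n. w (z k)) = wdist w y b"
    using z mn by (simp add: least_cost_walk_def lessThan_atLeast0 sum.atLeastLessThan_concat)
  moreover have "wdist w y b \<le> 2 * gd x y + (gd x a + D)"
  proof -
    have "wdist w y b \<le> wdist w y x + (wdist w x a + wdist w a b)"
      using wdist_triangle V by (meson add_left_mono le_trans)
    moreover have "wdist w y x \<le> 2 * gd x y"
      using wdist_le_gd[of y x w 2] V w(2) gd_sym[of x y] by simp
    moreover have "wdist w x a \<le> gd x a"
      using wdist_along[OF MA x ab(1) AB(1) h(1)] by (simp add: w_def)
    moreover have "wdist w a b \<le> D"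
    proof -
      obtain p where p: "walk a b (gd a b) p" using geodesic_walk V by blast
      have "p k \<in> set_nbhd E V A h" if "k < gd a b" for k
      proof -
        have "p k \<in> V" "gd a (p k) = k"
          using walk_vertex[OF p] geodesic_walk_distances[OF p V(2)] that by auto
        then show ?thesis using that ab h V gd_sym[of a "p k"]
          by (auto simp: set_nbhd_def intro!: bexI[of _ a])
      qed
      then show ?thesis using wdist_le[OF p, of w] ab by (simp add: w_def)
    qed
    ultimately show ?thesis by linarith
  qed
  moreover have "gd x a \<le> gd x y + (gd y (z m) + (gd (z m) b + gd b a))"
    using gd_triangle V zmV by (meson add_left_mono le_trans)
  moreover have "gd y (z m) \<le> m" using gd_walk_le[OF wz, of 0 m] mn zn by simp
  moreover have "gd b a \<le> D" using ab gd_sym[of a b] V by simp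
  ultimately have "m \<le> 3 * gd x y + 2 * D" by linarith
  moreover have "walk y (z m) m z" using walk_segment[OF wz, of 0 m] mn zn by simp
  moreover have "z m \<in> set_nbhd E V B M"
    using least_cost_walk_near[of B 2 M w y b n z m] MB w z y ab AB mn by simp
  ultimately show thesis using that[of "z m" m z] before zm by blast
qed

lemma wdist_le_few_heavy:
  assumes x: "walk u v n x" and low: "\<And>k. k < n \<Longrightarrow> x k \<in> N \<Longrightarrow> k \<in> I" and I: "finite I" "card I \<le> c"
  shows "wdist (\<lambda>z. if z \<in> N then L else 1) u v \<le> n + L * c"
proof -
  have "wdist (\<lambda>z. if z \<in> N then L else 1) u v \<le> (\<Sum>k<n. if x k \<in> N then L else 1)"
    using wdist_le[OF x] .
  also have "\<dots> \<le> (\<Sum>k<n. 1 + (if x k \<in> N then L else 0))" by (intro sum_mono) auto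
  also have "\<dots> = n + (\<Sum>k<n. if x k \<in> N then L else 0)" by (simp only: sum.distrib) simp
  also have "(\<Sum>k<n. if x k \<in> N then L else 0) = L * card {k. k < n \<and> x k \<in> N}"
    by (simp add: sum.If_cases Int_def mult.commute)
  also have "card {k. k < n \<and> x k \<in> N} \<le> c"
  proof -
    have "{k. k < n \<and> x k \<in> N} \<subseteq> I" using low by blast
    then show ?thesis using card_mono[OF I(1)] I(2) le_trans by blast
  qed
  finally show ?thesis by simp
qed

text \<open>
  Nearest-point projection to a Morse subset contracts: if \<open>x\<close> is a point of \<open>A\<close> nearest to \<open>v\<close>, and
  \<open>y\<close> is no farther from \<open>v\<close> than \<open>A\<close> is, then a descent of length \<open>m\<close> from \<open>y\<close> to \<open>A\<close>
  ends, up to a constant, within a small fraction of \<open>gd x v\<close> and \<open>m\<close> from \<open>x\<close>. Make the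
  vertices near \<open>A\<close> sixteen times as expensive as the others. The least-cost walk from \<open>x\<close> to \<open>e'\<close> still stays near \<open>A\<close>, so it pays
  16 at each step. The route through \<open>v\<close>, \<open>y\<close> and \<open>e\<close> is longer but meets the expensive region in
  boundedly many vertices only: at the start, since \<open>x\<close> is nearest to \<open>v\<close>; in the last \<open>h\<close> of the
  first \<open>gd x v\<close> steps after \<open>v\<close>; and after \<open>e\<close>.
\<close>

lemma contraction:
  assumes MA: "morse_radius E V A 16 0 M" and A: "A \<subseteq> V" and h: "M \<le> h"
    and "v \<in> V" and x: "x \<in> A" "\<And>a. a \<in> A \<Longrightarrow> gd x v \<le> gd v a"
    and y: "y \<in> V" "gd v y \<le> gd x v"
    and z: "walk y e m z" "\<And>k. k < m \<Longrightarrow> z k \<notin> set_nbhd E V A h"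
    and e: "e' \<in> A" "gd e e' \<le> h"
  shows "16 * gd x e' \<le> 2 * gd x v + m + (48 * h + 16)"
proof -
  let ?N = "set_nbhd E V A h"
  define w where "w z = (if z \<in> ?N then 16 else 1 :: nat)" for z
  have w: "1 \<le> w z" "w z \<le> 16" for z by (auto simp: w_def)
  have V: "x \<in> V" "v \<in> V" "y \<in> V" "e \<in> V" "e' \<in> V"
    using A x y e \<open>v \<in> V\<close> walk_vertex[OF z(1), of m] z(1) by (auto simp: walk_def)
  obtain n p where p: "least_cost_walk w x e' n p" using least_cost_walk_exists V by blast
  have wp: "walk x e' n p" using p by (simp add: least_cost_walk_def)
  have "w (p k) = 16" if "k < n" for k
    using least_cost_walk_near[of A 16 M w x e' n p k] MA w p x e A that h
    by (force simp: w_def set_nbhd_def)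
  then have "16 * n = wdist w x e'" using p by (simp add: least_cost_walk_def)
  moreover have "wdist w x e' \<le> wdist w x v + (wdist w v y + (wdist w y e + wdist w e e'))"
    using wdist_triangle V by (meson add_left_mono le_trans)
  moreover have "wdist w x v \<le> gd x v + (16 * h + 16)"
  proof -
    obtain q where q: "walk x v (gd x v) q" using geodesic_walk V by blast
    have "k \<in> {..h}" if k: "k < gd x v" "q k \<in> ?N" for k
    proof -
      from k obtain a where a: "a \<in> A" "gd (q k) a \<le> h" "q k \<in> V" by (auto simp: set_nbhd_def)
      have "gd (q k) v = gd x v - k" using geodesic_walk_distances[OF q V(2)] k by simp
      moreover have "gd v a \<le> gd v (q k) + gd (q k) a" using gd_triangle V a A by blast
      moreover have "gd x v \<le> gd v a" using x a by blast
      ultimately show ?thesis using a k gd_sym[of v "q k"] V by auto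
    qed
    then have "wdist w x v \<le> gd x v + 16 * (h + 1)" unfolding w_def[abs_def]
      by (intro wdist_le_few_heavy[OF q, of _ "{..h}"]) auto
    then show ?thesis by simp
  qed
  moreover have "wdist w v y \<le> gd x v + 16 * h"
  proof -
    obtain q where q: "walk v y (gd v y) q" using geodesic_walk V by blast
    have "k \<in> {gd x v - h..<gd x v}" if k: "k < gd v y" "q k \<in> ?N" for k
    proof -
      from k obtain a where a: "a \<in> A" "gd (q k) a \<le> h" "q k \<in> V" by (auto simp: set_nbhd_def)
      have "gd v (q k) = k" using geodesic_walk_distances[OF q V(3)] k by simp
      moreover have "gd v a \<le> gd v (q k) + gd (q k) a" using gd_triangle V a A by blast
      moreover have "gd x v \<le> gd v a" using x a by blast
      ultimately show ?thesis using a k y by auto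
    qed
    then have "wdist w v y \<le> gd v y + 16 * h"
      unfolding w_def[abs_def] by (intro wdist_le_few_heavy[OF q, of _ "{gd x v - h..<gd x v}"]) auto
    then show ?thesis using y(2) by linarith
  qed
  moreover have "wdist w y e \<le> m"
    using wdist_le_few_heavy[OF z(1), of ?N "{}" 0 16] z(2) by (simp add: w_def[abs_def])
  moreover have "wdist w e e' \<le> 16 * h"
    using wdist_le_gd[of e e' w 16] V w(2) e(2) by fastforce
  moreover have "16 * gd x e' \<le> 16 * n" using gd_le_walk[OF wp] by simp
  ultimately show ?thesis by linarith
qed

text \<open>
  With the walk from \<open>y\<close> to \<open>e\<close> of length at most \<open>3 * gd x y + 2 * D \<le> 6 * gd x v + 2 * D\<close>, the
  contraction estimate reads \<open>16 * gd x e' \<le> 8 * gd x v + const\<close>; the weight 16 is chosen to make the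
  factor \<open>8 / 16\<close> less than 1.
\<close>

lemma nearest_point_close:
  assumes MA: "morse_radius E V A 16 0 M" and MB: "morse_radius E V B 16 0 M"
    and AB: "A \<subseteq> V" "B \<subseteq> V" and ab: "a \<in> A" "b \<in> B" "gd a b \<le> D"
    and "v \<in> V" and x: "x \<in> A" "\<And>a. a \<in> A \<Longrightarrow> gd x v \<le> gd v a" and y: "y \<in> B" "gd v y \<le> gd x v"
  shows "\<exists>b\<in>B. 2 * gd x b \<le> gd x v + (12 * M + 10 * D + 2)"
proof -
  let ?h = "M + D"
  have M1: "morse_radius E V A 1 0 M" and M2: "morse_radius E V B 2 0 M"
    using morse_radius_mono[OF MA, of 1 0 M] morse_radius_mono[OF MB, of 2 0 M] by auto
  obtain e m z where z: "walk y e m z" "m \<le> 3 * gd x y + 2 * D"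
    "\<And>k. k < m \<Longrightarrow> z k \<notin> set_nbhd E V A ?h" "e \<in> set_nbhd E V A ?h" "e \<in> set_nbhd E V B M"
    using walk_to_intersection[OF M1 M2 AB _ _ ab x(1) y(1), of ?h] by auto
  obtain e' where e': "e' \<in> A" "gd e e' \<le> ?h" using z by (auto simp: set_nbhd_def)
  obtain b' where b': "b' \<in> B" "gd e b' \<le> M" using z by (auto simp: set_nbhd_def)
  have V: "x \<in> V" "y \<in> V" "e \<in> V" "e' \<in> V" "b' \<in> V"
    using AB x y e' b' z by (auto simp: set_nbhd_def)
  have "16 * gd x e' \<le> 2 * gd x v + m + (48 * ?h + 16)"
    using contraction[OF MA AB(1) _ \<open>v \<in> V\<close> x _ y(2) z(1,3) e'] V by simp
  moreover have "m \<le> 6 * gd x v + 2 * D"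
  proof -
    have "gd x y \<le> gd x v + gd v y" using gd_triangle V \<open>v \<in> V\<close> by blast
    then show ?thesis using z(2) y(2) by linarith
  qed
  ultimately have "16 * gd x e' \<le> 8 * gd x v + 48 * M + 50 * D + 16" by simp
  moreover have "gd x b' \<le> gd x e' + 2 * M + D"
  proof -
    have "gd x b' \<le> gd x e' + (gd e' e + gd e b')"
      using gd_triangle V by (meson add_left_mono le_trans)
    moreover have "gd e' e \<le> M + D" using e' gd_sym[of e e'] V by simp
    ultimately show ?thesis using b'(2) by linarith
  qed
  ultimately have "2 * gd x b' \<le> gd x v + (12 * M + 10 * D + 2)" by linarith
  then show ?thesis using b' by blast
qed

text \<open>
  A Helly property with a constant that does not depend on the number of sets. Choose \<open>o'\<close> so that the
  maximal distance \<open>t\<close> to the sets is least, and let \<open>x\<close> be a nearest point to it on a set \<open>A\<close> at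
  distance \<open>t\<close>. Every other set is at distance at most \<open>t\<close> from \<open>o'\<close>, so \<open>nearest_point_close\<close> puts it
  within \<open>(t + c) / 2\<close> of \<open>x\<close>. By minimality \<open>t \<le> (t + c) / 2\<close>, that is, \<open>t \<le> c\<close>.
\<close>

lemma common_near_point:
  assumes fin: "finite \<A>" and ne: "\<A> \<noteq> {}"
    and M: "\<And>A. A \<in> \<A> \<Longrightarrow> morse_radius E V A 16 0 M"
    and sub: "\<And>A. A \<in> \<A> \<Longrightarrow> A \<subseteq> V \<and> A \<noteq> {}"
    and close: "\<And>A B. A \<in> \<A> \<Longrightarrow> B \<in> \<A> \<Longrightarrow> \<exists>a\<in>A. \<exists>b\<in>B. gd a b \<le> D"
  shows "\<exists>v\<in>V. \<forall>A\<in>\<A>. \<exists>a\<in>A. gd v a \<le> 12 * M + 10 * D + 2"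
proof -
  let ?c = "12 * M + 10 * D + 2"
  define P where "P t \<longleftrightarrow> (\<exists>v\<in>V. \<forall>A\<in>\<A>. \<exists>a\<in>A. gd v a \<le> t)" for t
  have ex: "\<exists>t. P t"
  proof -
    obtain f where f: "\<And>A. A \<in> \<A> \<Longrightarrow> f A \<in> A" 
    proof -
      have "(SOME a. a \<in> A) \<in> A" if "A \<in> \<A>" for A
        using sub[OF that] by (simp add: some_in_eq)
      then show thesis by (rule that)
    qed
    obtain A0 where A0: "A0 \<in> \<A>" using ne by blast
    have "gd (f A0) (f A) \<le> (\<Sum>A\<in>\<A>. gd (f A0) (f A))" if "A \<in> \<A>" for A
      using member_le_sum[OF that, of "\<lambda>A. gd (f A0) (f A)"] fin by simp
    then have "P (\<Sum>A\<in>\<A>. gd (f A0) (f A))"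
      unfolding P_def using f f[OF A0] sub[OF A0] by blast
    then show ?thesis ..
  qed
  define t where "t = (LEAST t. P t)"
  have Pt: "P t" unfolding t_def by (rule LeastI_ex[OF ex])
  have least: "t \<le> s" if "P s" for s unfolding t_def using that by (rule Least_le)
  have "t \<le> ?c"
  proof (cases "t = 0")
    case False
    obtain o' where o': "o' \<in> V" "\<forall>A\<in>\<A>. \<exists>a\<in>A. gd o' a \<le> t" using Pt by (auto simp: P_def)
    have "\<not> P (t - 1)" using least[of "t - 1"] False by auto
    then have "\<not> (\<forall>A\<in>\<A>. \<exists>a\<in>A. gd o' a \<le> t - 1)" using o'(1) unfolding P_def by blast
    then obtain A where A: "A \<in> \<A>" "\<forall>a\<in>A. t - 1 < gd o' a" by (meson not_less)
    obtain x where x: "x \<in> A" "gd o' x \<le> t" using o' A by blast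
    have AV: "A \<subseteq> V" using sub A by blast
    have "t - 1 < gd o' x" using A x by blast
    then have xt: "gd x o' = t" using x gd_sym[of x o'] o' AV False by auto
    have far: "gd x o' \<le> gd o' a" if "a \<in> A" for a
    proof -
      have "t - 1 < gd o' a" using A(2) that by blast
      then show ?thesis using xt by linarith
    qed
    have near: "\<exists>b\<in>B. 2 * gd x b \<le> t + ?c" if B: "B \<in> \<A>" for B
    proof -
      obtain a b where ab: "a \<in> A" "b \<in> B" "gd a b \<le> D" using close[OF A(1) B] by blast
      obtain y where y: "y \<in> B" "gd o' y \<le> gd x o'" using o' B xt by blast
      have "B \<subseteq> V" using sub B by blast
      from nearest_point_close[OF M[OF A(1)] M[OF B] AV this ab o'(1) x(1) far y]
      show ?thesis unfolding xt .
    qed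
    have "\<forall>B\<in>\<A>. \<exists>b\<in>B. gd x b \<le> (t + ?c) div 2" 
    proof (intro ballI)
      fix B assume "B \<in> \<A>"
      then obtain b where "b \<in> B" "2 * gd x b \<le> t + ?c" using near by blast
      moreover from this have "gd x b \<le> (t + ?c) div 2" by linarith
      ultimately show "\<exists>b\<in>B. gd x b \<le> (t + ?c) div 2" by blast
    qed
    then have "P ((t + ?c) div 2)" using x AV unfolding P_def by blast
    from least[OF this] show ?thesis by linarith
  qed simp
  obtain v where v: "v \<in> V" "\<forall>A\<in>\<A>. \<exists>a\<in>A. gd v a \<le> t" using Pt by (auto simp: P_def)
  have "\<forall>A\<in>\<A>. \<exists>a\<in>A. gd v a \<le> ?c" using v(2) \<open>t \<le> ?c\<close> by (meson le_trans)
  then show ?thesis using v(1) by blast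
qed

end


section \<open>Changing the graph\<close>

lemma vertex_distance_lipschitz:
  assumes "connected_graph V E" "connected_graph V' E'" "V \<subseteq> V'"
    and step: "\<And>u v. (u, v) \<in> E \<Longrightarrow> vertex_distance E' u v \<le> K" and uv: "u \<in> V" "v \<in> V"
  shows "vertex_distance E' u v \<le> K * vertex_distance E u v"
proof -
  interpret X: connected_graph V E by fact
  interpret Y: connected_graph V' E' by fact
  have "vertex_distance E' u v \<le> K * n" if "(u, v) \<in> E ^^ n" "v \<in> V" for n v
    using that
  proof (induction n arbitrary: v)
    case (Suc n)
    then obtain z where z: "(u, z) \<in> E ^^ n" "(z, v) \<in> E" by auto
    then have V: "z \<in> V" "v \<in> V" using X.edges by auto
    have "vertex_distance E' u v \<le> vertex_distance E' u z + vertex_distance E' z v"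
      using V uv assms(3) by (intro Y.gd_triangle) auto
    also have "\<dots> \<le> K * n + K" using Suc.IH[OF z(1) V(1)] step[OF z(2)] by (rule add_mono)
    finally show ?case by simp
  qed simp
  then show ?thesis using X.gd_walk[OF uv] uv by blast
qed

text \<open>
  A bi-Lipschitz inclusion turns quasi-geodesics of the smaller graph into quasi-geodesics of the
  larger one. This serves twice: for two generating sets of the same group, and for a subgroup with
  its own word metric.
\<close>

lemma vertex_morse_transfer:
  assumes morse: "vertex_morse E V A" and V': "V' \<subseteq> V" "A \<subseteq> V'"
    and upper: "\<And>u v. u \<in> V' \<Longrightarrow> v \<in> V' \<Longrightarrow> vertex_distance E u v \<le> L * vertex_distance E' u v"
    and lower: "\<And>u v. u \<in> V' \<Longrightarrow> v \<in> V' \<Longrightarrow> vertex_distance E' u v \<le> L' * vertex_distance E u v"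
  shows "vertex_morse E' V' A"
  unfolding vertex_morse_def
proof (intro conjI allI impI)
  show "A \<subseteq> V'" by fact
  fix K C :: real assume K: "1 \<le> K" and C: "0 \<le> C"
  define N where "N = max 1 (max L L')"
  have N: "1 \<le> N" "L \<le> N" "L' \<le> N" by (auto simp: N_def)
  have KN: "1 \<le> real N * K" "0 \<le> real N * C"
    using N K C mult_mono[of 1 "real N" 1 K] by auto
  then obtain M where M: "morse_radius E V A (real N * K) (real N * C) M"
    using morse unfolding vertex_morse_def by blast
  have "morse_radius E' V' A K C (N * M)"
    unfolding morse_radius_def
  proof (intro allI impI)
    fix n x i assume "vertex_quasi_geodesic E' V' K C n x \<and> x 0 \<in> A \<and> x n \<in> A" and i: "i \<le> n"
    then have x: "vertex_quasi_geodesic E' V' K C n x" and ends: "x 0 \<in> A" "x n \<in> A" by auto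
    have xV: "x k \<in> V'" if "k \<le> n" for k using x that by (simp add: vertex_quasi_geodesic_def)
    have "vertex_quasi_geodesic E V (real N * K) (real N * C) n x"
      unfolding vertex_quasi_geodesic_def
    proof (intro conjI allI impI)
      show "x k \<in> V" if "k \<le> n" for k using xV[OF that] V' by blast
      fix i j assume ij: "j \<le> n" "i \<le> j"
      have d: "1 / K * (real j - real i) - C \<le> real (vertex_distance E' (x i) (x j))"
        "real (vertex_distance E' (x i) (x j)) \<le> K * (real j - real i) + C"
        using x ij unfolding vertex_quasi_geodesic_def by blast+
      have V: "x i \<in> V'" "x j \<in> V'" using xV ij by auto
      have "vertex_distance E' (x i) (x j) \<le> N * vertex_distance E (x i) (x j)"
        using lower[OF V] N(3) by (meson le_trans mult_le_mono1)
      then have "real (vertex_distance E' (x i) (x j)) \<le> real N * real (vertex_distance E (x i) (x j))"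
        by (metis of_nat_le_iff of_nat_mult)
      with d have "1 / K * (real j - real i) - C \<le> real N * real (vertex_distance E (x i) (x j))"
        by linarith
      then have "(1 / K * (real j - real i) - C) / real N \<le> real (vertex_distance E (x i) (x j))"
        using N by (simp add: divide_le_eq mult.commute)
      moreover have "C / real N \<le> real N * C"
      proof -
        have "C / real N \<le> C / 1" using N C by (intro divide_left_mono) auto
        also have "\<dots> \<le> real N * C" using N C mult_right_mono[of 1 "real N" C] by simp
        finally show ?thesis .
      qed
      moreover have "(1 / K * (real j - real i) - C) / real N
          = 1 / (real N * K) * (real j - real i) - C / real N"
        by (simp add: diff_divide_distrib mult.commute)
      ultimately show "1 / (real N * K) * (real j - real i) - real N * C
          \<le> real (vertex_distance E (x i) (x j))" by linarith
      have "vertex_distance E (x i) (x j) \<le> N * vertex_distance E' (x i) (x j)"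
        using upper[OF V] N(2) by (meson le_trans mult_le_mono1)
      then have "real (vertex_distance E (x i) (x j)) \<le> real N * real (vertex_distance E' (x i) (x j))"
        by (metis of_nat_le_iff of_nat_mult)
      also have "\<dots> \<le> real N * (K * (real j - real i) + C)"
        using d by (intro mult_left_mono) auto
      finally show "real (vertex_distance E (x i) (x j))
          \<le> real N * K * (real j - real i) + real N * C" by (simp add: algebra_simps)
    qed
    then obtain a where a: "a \<in> A" "vertex_distance E (x i) a \<le> M"
      using M ends i unfolding morse_radius_def by blast
    have "vertex_distance E' (x i) a \<le> L' * vertex_distance E (x i) a"
      using lower xV[OF i] a V' by blast
    also have "\<dots> \<le> N * M" using N a by (intro mult_le_mono)
    finally show "\<exists>a\<in>A. vertex_distance E' (x i) a \<le> N * M" using a by blast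
  qed
  then show "\<exists>M. morse_radius E' V' A K C M" by blast
qed


section \<open>Word metrics\<close>

lemma (in group) conjugate_iff:
  "x \<in> conjugate G g H \<longleftrightarrow> (\<exists>h\<in>H. x = g \<otimes> h \<otimes> inv g)"
  by (auto simp: conjugate_def l_coset_def r_coset_def)

locale word_metric = group G for G (structure) +
  fixes S
  assumes generating: "finite_generating_set G S"

sublocale word_metric \<subseteq> connected_graph "carrier G" "cayley_edges G S"
  by (rule connected_cayley_graph[OF group_axioms generating])

context word_metric
begin

abbreviation "EG \<equiv> cayley_edges G S"

lemma S_carrier: "s \<in> S \<Longrightarrow> s \<in> carrier G" and finite_S: "finite S"
  using generating by (auto simp: finite_generating_set_def)

lemma gd_translate:
  assumes "g \<in> carrier G" "x \<in> carrier G" "y \<in> carrier G"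
  shows "gd (g \<otimes> x) (g \<otimes> y) = gd x y"
proof -
  have edge: "(g \<otimes> x, g \<otimes> y) \<in> EG" if "(x, y) \<in> EG" "g \<in> carrier G" for g x y
    using that S_carrier by (auto simp: cayley_edges_def m_assoc)
  have walk: "(g \<otimes> x, g \<otimes> y) \<in> EG ^^ n" if "(x, y) \<in> EG ^^ n" "g \<in> carrier G" for g x y n
    using that(1)
  proof (induction n arbitrary: y)
    case (Suc n)
    then show ?case using edge[OF _ that(2)] by auto
  qed simp
  have le: "gd (g \<otimes> x) (g \<otimes> y) \<le> gd x y"
    if "g \<in> carrier G" "x \<in> carrier G" "y \<in> carrier G" for g x y
    using gd_le[OF walk[OF gd_walk]] that by blast
  have "gd (inv g \<otimes> (g \<otimes> x)) (inv g \<otimes> (g \<otimes> y)) \<le> gd (g \<otimes> x) (g \<otimes> y)"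
    using le[of "inv g" "g \<otimes> x" "g \<otimes> y"] assms by simp
  then show ?thesis using le[OF assms] assms by (simp add: m_assoc[symmetric])
qed

lemma gd_translate_one: "x \<in> carrier G \<Longrightarrow> y \<in> carrier G \<Longrightarrow> gd x y = gd \<one> (inv x \<otimes> y)"
  using gd_translate[of "inv x" x y] by simp

definition word_ball :: "nat \<Rightarrow> 'a set" where
  "word_ball n = {x \<in> carrier G. gd \<one> x \<le> n}"

text \<open>
  Local finiteness of the Cayley graph is what turns all the metric statements about points near
  several cosets into finiteness statements.
\<close>

lemma finite_word_ball: "finite (word_ball n)"
proof (induction n)
  case 0
  have "word_ball 0 \<subseteq> {\<one>}" using gd_eq_0[of \<one>] by (auto simp: word_ball_def)
  then show ?case by (rule finite_subset) simp
next
  case (Suc n)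
  have "word_ball (Suc n) \<subseteq> word_ball n \<union> (\<Union>y\<in>word_ball n. \<Union>s\<in>S. {y \<otimes> s, y \<otimes> inv s})"
  proof
    fix x assume x: "x \<in> word_ball (Suc n)"
    show "x \<in> word_ball n \<union> (\<Union>y\<in>word_ball n. \<Union>s\<in>S. {y \<otimes> s, y \<otimes> inv s})"
    proof (cases "gd \<one> x \<le> n")
      case False
      then have "gd \<one> x = Suc n" "x \<in> carrier G" using x by (auto simp: word_ball_def)
      then have "(\<one>, x) \<in> EG ^^ Suc n" using gd_walk[of \<one> x] by simp
      then obtain y where y: "(\<one>, y) \<in> EG ^^ n" "(y, x) \<in> EG" by auto
      then have yG: "y \<in> carrier G" "x \<in> carrier G" using edges by auto
      obtain s where s: "s \<in> S" "x = y \<otimes> s \<or> y = x \<otimes> s"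
        using y(2) by (auto simp: cayley_edges_def)
      have "s \<in> carrier G" using s S_carrier by blast
      then have "x = y \<otimes> s \<or> x = y \<otimes> inv s"
        using s(2) yG inv_solve_right by auto
      moreover have "y \<in> word_ball n" using gd_le[OF y(1)] yG by (simp add: word_ball_def)
      ultimately show ?thesis using s(1) by blast
    qed (use x in \<open>simp add: word_ball_def\<close>)
  qed
  then show ?case using Suc finite_S by (auto intro: finite_subset)
qed

lemma word_dist_lipschitz:
  assumes "subgroup H G" and T: "finite_generating_set (G\<lparr>carrier := H\<rparr>) T"
  shows "\<exists>K. \<forall>x\<in>H. \<forall>y\<in>H. gd x y \<le> K * vertex_distance (cayley_edges (G\<lparr>carrier := H\<rparr>) T) x y"
proof -
  interpret H: subgroup H G by fact
  have TH: "finite T" "T \<subseteq> H" using T by (auto simp: finite_generating_set_def)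
  let ?K = "\<Sum>t\<in>T. gd \<one> t"
  let ?E = "cayley_edges (G\<lparr>carrier := H\<rparr>) T"
  have t: "gd u (u \<otimes> t) \<le> ?K" if "u \<in> carrier G" "t \<in> T" for u t
  proof -
    have "t \<in> carrier G" using that TH H.subset by blast
    then have "gd u (u \<otimes> t) = gd \<one> t" using gd_translate[of u \<one> t] that by simp
    then show ?thesis using member_le_sum[of t T "gd \<one>"] that TH by simp
  qed
  have "gd u v \<le> ?K" if uv: "(u, v) \<in> ?E" for u v
  proof -
    have V: "u \<in> carrier G" "v \<in> carrier G" using uv H.subset by (auto simp: cayley_edges_def)
    obtain s where "s \<in> T" "v = u \<otimes> s \<or> u = v \<otimes> s" using uv by (auto simp: cayley_edges_def)
    then show ?thesis using t[of u s] t[of v s] V gd_sym[OF V] by auto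
  qed
  then have "gd x y \<le> ?K * vertex_distance ?E x y" if "x \<in> H" "y \<in> H" for x y
    using vertex_distance_lipschitz[of H ?E "carrier G" EG ?K x y]
      connected_cayley_graph[OF H.subgroup_is_group[OF group_axioms] T]
      connected_graph_axioms H.subset that by auto
  then show ?thesis by blast
qed

lemma morse_radius_coset:
  assumes M: "morse_radius EG (carrier G) H K C M" and H: "H \<subseteq> carrier G" and g: "g \<in> carrier G"
  shows "morse_radius EG (carrier G) (g <# H) K C M"
  unfolding morse_radius_def
proof (intro allI impI)
  fix n x i
  assume "vertex_quasi_geodesic EG (carrier G) K C n x \<and> x 0 \<in> g <# H \<and> x n \<in> g <# H"
    and i: "i \<le> n"
  then have x: "vertex_quasi_geodesic EG (carrier G) K C n x"
    and ends: "x 0 \<in> g <# H" "x n \<in> g <# H" by auto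
  have xG: "x k \<in> carrier G" if "k \<le> n" for k using x that by (simp add: vertex_quasi_geodesic_def)
  define y where "y k = inv g \<otimes> x k" for k
  have "gd (y j) (y k) = gd (x j) (x k)" if "j \<le> n" "k \<le> n" for j k
    using gd_translate[of "inv g"] xG that g by (simp add: y_def)
  then have "vertex_quasi_geodesic EG (carrier G) K C n y"
    using x xG g unfolding vertex_quasi_geodesic_def by (auto simp: y_def)
  moreover have "inv g \<otimes> z \<in> H" if "z \<in> g <# H" for z
    using that g H by (auto simp: l_coset_def m_assoc[symmetric] subset_iff)
  then have "y 0 \<in> H" "y n \<in> H" using ends by (auto simp: y_def)
  ultimately obtain h where h: "h \<in> H" "gd (y i) h \<le> M"
    using M i unfolding morse_radius_def by blast
  have hG: "h \<in> carrier G" using h H by blast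
  have "gd (x i) (g \<otimes> h) = gd (y i) h"
    using gd_translate[of g "y i" h] xG[OF i] g hG by (simp add: y_def m_assoc[symmetric])
  then show "\<exists>a\<in>g <# H. gd (x i) a \<le> M"
    using h by (intro bexI[of _ "g \<otimes> h"]) (auto simp: l_coset_def)
qed

lemma strongly_quasiconvex_if_vertex_morse:
  "subgroup H G \<Longrightarrow> vertex_morse EG (carrier G) H \<Longrightarrow> strongly_quasiconvex G H"
  unfolding strongly_quasiconvex_def cayley_graph_def
  using generating morse_subset_if_vertex_morse by blast

lemma vertex_morse_if_strongly_quasiconvex:
  assumes "strongly_quasiconvex G H"
  shows "vertex_morse EG (carrier G) H"
proof -
  obtain S' where H: "subgroup H G" and S': "finite_generating_set G S'"
    and morse: "morse_subset (cayley_graph G S') (vertex_point ` H)"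
    using assms by (auto simp: strongly_quasiconvex_def)
  have HG: "H \<subseteq> carrier G" using H by (rule subgroup.subset)
  interpret S': word_metric G S' by unfold_locales (rule S')
  have vm: "vertex_morse S'.EG (carrier G) H"
    using S'.vertex_morse_if_morse_subset HG morse by (simp add: cayley_graph_def)
  obtain L where "\<forall>x\<in>carrier G. \<forall>y\<in>carrier G. gd x y \<le> L * vertex_distance S'.EG x y"
    using word_dist_lipschitz[OF subgroup_self, of S'] S' by auto
  moreover obtain L' where "\<forall>x\<in>carrier G. \<forall>y\<in>carrier G. vertex_distance S'.EG x y \<le> L' * gd x y"
    using S'.word_dist_lipschitz[OF subgroup_self, of S] generating by auto
  ultimately show ?thesis using vertex_morse_transfer[OF vm order_refl HG] by blast
qed


section \<open>Finite generation and distortion\<close>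

text \<open>
  A geodesic between two elements of \<open>H\<close> stays within \<open>M\<close> of \<open>H\<close>. Replacing its vertices by nearby
  elements of \<open>H\<close> writes the quotient of its end points as a product of elements of \<open>H\<close> of length at
  most \<open>M + 1 + M\<close>, one for each edge of the geodesic.
\<close>

lemma quasiconvex_generating_set:
  assumes "subgroup H G" and morse: "vertex_morse EG (carrier G) H"
  shows "\<exists>T. finite_generating_set (G\<lparr>carrier := H\<rparr>) T \<and>
    (\<forall>u\<in>H. \<forall>v\<in>H. vertex_distance (cayley_edges (G\<lparr>carrier := H\<rparr>) T) u v \<le> gd u v)"
proof -
  interpret H: subgroup H G by fact
  obtain M where M: "morse_radius EG (carrier G) H 1 0 M"
    using morse unfolding vertex_morse_def by (metis order_refl)
  define T where "T = {h \<in> H. gd \<one> h \<le> 2 * M + 1}"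
  have T: "T \<subseteq> H" "finite T"
  proof -
    have "T \<subseteq> word_ball (2 * M + 1)" using H.subset by (auto simp: T_def word_ball_def)
    then show "finite T" using finite_word_ball finite_subset by blast
  qed (simp add: T_def)
  have chain: "\<exists>f. f 0 = u \<and> f (gd u v) = v \<and> (\<forall>i\<le>gd u v. f i \<in> H) \<and>
      (\<forall>i<gd u v. inv (f i) \<otimes> f (Suc i) \<in> T)" if uv: "u \<in> H" "v \<in> H" for u v
  proof -
    let ?n = "gd u v"
    have uvG: "u \<in> carrier G" "v \<in> carrier G" using uv H.subset by auto
    obtain x where x: "walk u v ?n x" using geodesic_walk[OF uvG] .
    have "\<exists>a\<in>H. gd (x i) a \<le> M" if "i \<le> ?n" for i
      using geodesic_near[OF M uv H.subset x that] by (simp add: set_nbhd_def)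
    then obtain a where a: "\<And>i. i \<le> ?n \<Longrightarrow> a i \<in> H \<and> gd (x i) (a i) \<le> M" by metis
    define f where "f i = (if i = 0 then u else if i = ?n then v else a i)" for i
    have "?n = 0 \<Longrightarrow> u = v" using gd_eq_0 uvG by blast
    then have ends: "f 0 = u" "f ?n = v" by (auto simp: f_def)
    have fi: "f i \<in> H" "gd (x i) (f i) \<le> M" if "i \<le> ?n" for i
      using a[OF that] uv x by (auto simp: f_def walk_def)
    have "inv (f i) \<otimes> f (Suc i) \<in> T" if i: "i < ?n" for i
    proof -
      have H: "f i \<in> H" "f (Suc i) \<in> H" using fi i by auto
      have V: "f i \<in> carrier G" "f (Suc i) \<in> carrier G" using H H.subset by auto
      have xV: "x i \<in> carrier G" "x (Suc i) \<in> carrier G" using walk_vertex[OF x] i by auto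
      have "gd (f i) (f (Suc i)) \<le> gd (f i) (x i) + (gd (x i) (x (Suc i)) + gd (x (Suc i)) (f (Suc i)))"
        using gd_triangle V xV by (meson add_left_mono le_trans)
      also have "\<dots> \<le> M + (1 + M)"
        using fi[of i] fi[of "Suc i"] i gd_sym[OF V(1) xV(1)] gd_walk_le[OF x, of i "Suc i"]
        by (intro add_mono) auto
      finally show ?thesis using H gd_translate_one[OF V] by (simp add: T_def)
    qed
    then show ?thesis using ends fi by blast
  qed
  have gen: "generate (G\<lparr>carrier := H\<rparr>) T = generate G T"
    using generate_consistent[OF T(1) \<open>subgroup H G\<close>] .
  have "H \<subseteq> generate G T"
  proof
    fix v assume v: "v \<in> H"
    obtain f where f: "f 0 = \<one>" "f (gd \<one> v) = v" "\<forall>i\<le>gd \<one> v. f i \<in> H"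
      "\<forall>i<gd \<one> v. inv (f i) \<otimes> f (Suc i) \<in> T" using chain[OF H.one_closed v] by blast
    have "f i \<in> generate G T" if "i \<le> gd \<one> v" for i
      using that
    proof (induction i)
      case 0
      then show ?case using f by (simp add: generate.one)
    next
      case (Suc i)
      have V: "f i \<in> carrier G" "f (Suc i) \<in> carrier G" using f(3) Suc.prems H.subset by auto
      have "f i \<otimes> (inv (f i) \<otimes> f (Suc i)) \<in> generate G T"
        using generate.eng[OF Suc.IH generate.incl] Suc.prems f(4) by simp
      then show ?case using V by (simp add: m_assoc[symmetric])
    qed
    from this[OF order_refl] show "v \<in> generate G T" unfolding f(2) .
  qed
  moreover have "generate G T \<subseteq> H"
    using generate_subgroup_incl[OF T(1) \<open>subgroup H G\<close>] .
  ultimately have fg: "finite_generating_set (G\<lparr>carrier := H\<rparr>) T"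
    using T gen by (simp add: finite_generating_set_def)
  let ?E = "cayley_edges (G\<lparr>carrier := H\<rparr>) T"
  interpret T: connected_graph H ?E
    using connected_cayley_graph[OF H.subgroup_is_group[OF group_axioms] fg] by simp
  have "vertex_distance ?E u v \<le> gd u v" if uv: "u \<in> H" "v \<in> H" for u v
  proof -
    obtain f where f: "f 0 = u" "f (gd u v) = v" "\<forall>i\<le>gd u v. f i \<in> H"
      "\<forall>i<gd u v. inv (f i) \<otimes> f (Suc i) \<in> T" using chain[OF uv] by blast
    have "vertex_distance ?E u (f i) \<le> i" if "i \<le> gd u v" for i
      using that
    proof (induction i)
      case (Suc i)
      have H: "f i \<in> H" "f (Suc i) \<in> H" using f(3) Suc.prems by auto
      have V: "f i \<in> carrier G" "f (Suc i) \<in> carrier G" using H H.subset by auto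
      have "inv (f i) \<otimes> f (Suc i) \<in> T" using f(4) Suc.prems by simp
      moreover have "f (Suc i) = f i \<otimes> (inv (f i) \<otimes> f (Suc i))"
        using V by (simp add: m_assoc[symmetric])
      ultimately have "\<exists>t\<in>T. f (Suc i) = f i \<otimes> t" by blast
      then have "f i = f (Suc i) \<or> (f i, f (Suc i)) \<in> ?E"
        using H by (auto simp: cayley_edges_def)
      then have "vertex_distance ?E (f i) (f (Suc i)) \<le> 1" using T.gd_edge by auto
      moreover have "vertex_distance ?E u (f (Suc i))
          \<le> vertex_distance ?E u (f i) + vertex_distance ?E (f i) (f (Suc i))"
        using T.gd_triangle uv H by blast
      ultimately show ?case using Suc by linarith
    qed (use f in simp)
    from this[OF order_refl] show ?thesis unfolding f(2) .
  qed
  then show ?thesis using fg by blast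
qed

lemma finitely_generated_if_strongly_quasiconvex:
  assumes "strongly_quasiconvex G H"
  shows "finitely_generated (G\<lparr>carrier := H\<rparr>)"
  using assms quasiconvex_generating_set vertex_morse_if_strongly_quasiconvex
  by (meson finitely_generated_def strongly_quasiconvex_def)

lemma word_dist_undistorted:
  assumes qc: "strongly_quasiconvex G H" and T: "finite_generating_set (G\<lparr>carrier := H\<rparr>) T"
  shows "\<exists>K. \<forall>x\<in>H. \<forall>y\<in>H. vertex_distance (cayley_edges (G\<lparr>carrier := H\<rparr>) T) x y \<le> K * gd x y"
proof -
  have H: "subgroup H G" using qc by (simp add: strongly_quasiconvex_def)
  obtain T0 where T0: "finite_generating_set (G\<lparr>carrier := H\<rparr>) T0"
    "\<forall>u\<in>H. \<forall>v\<in>H. vertex_distance (cayley_edges (G\<lparr>carrier := H\<rparr>) T0) u v \<le> gd u v"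
    using quasiconvex_generating_set[OF H] vertex_morse_if_strongly_quasiconvex[OF qc] by blast
  interpret H: word_metric "G\<lparr>carrier := H\<rparr>" T
    using subgroup.subgroup_is_group[OF H group_axioms] T
    by (simp add: word_metric_def word_metric_axioms_def)
  obtain K where K: "\<forall>x\<in>H. \<forall>y\<in>H. vertex_distance (cayley_edges (G\<lparr>carrier := H\<rparr>) T) x y
      \<le> K * vertex_distance (cayley_edges (G\<lparr>carrier := H\<rparr>) T0) x y"
    using H.word_dist_lipschitz[OF H.subgroup_self, of T0] T0(1) by auto
  have "vertex_distance (cayley_edges (G\<lparr>carrier := H\<rparr>) T) x y \<le> K * gd x y"
    if "x \<in> H" "y \<in> H" for x y
    using K T0(2) that by (meson le_trans mult_le_mono2)
  then show ?thesis by blast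
qed

lemma undistorted_inclusion:
  assumes qc: "strongly_quasiconvex G H" and T: "finite_generating_set (G\<lparr>carrier := H\<rparr>) T"
  shows "\<exists>K\<ge>1. \<exists>L\<ge>0. \<exists>\<Phi>. (\<forall>h\<in>H. \<Phi> (vertex_point h) = vertex_point h) \<and>
    qi_embedding (cayley_graph (G\<lparr>carrier := H\<rparr>) T) (cayley_graph G S) K L \<Phi>"
proof -
  have H: "subgroup H G" using qc by (simp add: strongly_quasiconvex_def)
  have HG: "H \<subseteq> carrier G" using H by (rule subgroup.subset)
  let ?X = "cayley_graph (G\<lparr>carrier := H\<rparr>) T" and ?Y = "cayley_graph G S"
  let ?E = "cayley_edges (G\<lparr>carrier := H\<rparr>) T"
  interpret X: connected_graph H ?E
    using connected_cayley_graph[OF subgroup.subgroup_is_group[OF H group_axioms] T] by simp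
  obtain K1 where K1: "\<forall>x\<in>H. \<forall>y\<in>H. X.gd x y \<le> K1 * gd x y"
    using word_dist_undistorted[OF assms] by blast
  obtain K2 where K2: "\<forall>x\<in>H. \<forall>y\<in>H. gd x y \<le> K2 * X.gd x y"
    using word_dist_lipschitz[OF H T] by blast
  define K where "K = real (max 1 (max K1 K2))"
  have K: "1 \<le> K" "real K1 \<le> K" "real K2 \<le> K" by (auto simp: K_def)
  define \<Phi> where "\<Phi> p = vertex_point (X.nearest_vertex p)" for p
  have Xgraph: "?X = graph_metric H ?E" "?Y = graph_metric (carrier G) EG"
    by (simp_all add: cayley_graph_def)
  have "qi_embedding ?X ?Y K (2 * K) \<Phi>"
    unfolding qi_embedding_def
  proof (intro conjI ballI)
    show "\<Phi> \<in> mspace ?X \<rightarrow> mspace ?Y"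
      unfolding \<Phi>_def Xgraph mspace_graph X.mspace_graph
      using X.nearest_vertex(2) HG by (blast intro: vertex_in_pts)
    fix p q assume "p \<in> mspace ?X" "q \<in> mspace ?X"
    then have pq: "p \<in> X.pts" "q \<in> X.pts" by (auto simp: Xgraph)
    let ?u = "X.nearest_vertex p" and ?v = "X.nearest_vertex q"
    have uv: "?u \<in> H" "?v \<in> H" using X.nearest_vertex(2) pq by auto
    have eq: "mdist ?Y (\<Phi> p) (\<Phi> q) = gd ?u ?v"
      unfolding \<Phi>_def Xgraph using uv HG by (intro mdist_vertices) auto
    have near: "\<bar>real (X.gd ?u ?v) - mdist ?X p q\<bar> \<le> 2"
      unfolding Xgraph using X.nearest_vertex_distance[OF pq] .
    have "real (X.gd ?u ?v) \<le> real (K1 * gd ?u ?v)" using K1 uv of_nat_le_iff by blast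
    also have "\<dots> \<le> K * real (gd ?u ?v)" using K(2) by (simp add: mult_right_mono)
    finally have lower: "real (X.gd ?u ?v) \<le> K * real (gd ?u ?v)" .
    have "real (gd ?u ?v) \<le> real (K2 * X.gd ?u ?v)" using K2 uv of_nat_le_iff by blast
    also have "\<dots> \<le> K * real (X.gd ?u ?v)" using K(3) by (simp add: mult_right_mono)
    also have "\<dots> \<le> K * (mdist ?X p q + 2)" using near K by (intro mult_left_mono) auto
    finally show "mdist ?Y (\<Phi> p) (\<Phi> q) \<le> K * mdist ?X p q + 2 * K"
      by (simp add: eq algebra_simps)
    have "mdist ?X p q \<le> K * real (gd ?u ?v) + 2" using near lower by linarith
    also have "\<dots> \<le> K * (real (gd ?u ?v) + 2 * K)"
      using K mult_mono[of 1 K 1 K] by (simp add: distrib_left)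
    finally have "mdist ?X p q / K \<le> real (gd ?u ?v) + 2 * K"
      using K by (simp add: divide_le_eq mult.commute)
    then show "1 / K * mdist ?X p q - 2 * K \<le> mdist ?Y (\<Phi> p) (\<Phi> q)" by (simp add: eq)
  qed
  moreover have "\<forall>h\<in>H. \<Phi> (vertex_point h) = vertex_point h"
    using X.nearest_vertex_vertex by (simp add: \<Phi>_def)
  moreover have "0 \<le> 2 * K" using K by simp
  ultimately show ?thesis using K(1) by blast
qed


section \<open>Intersections\<close>

text \<open>
  If \<open>x = h\<^sub>1 a = h\<^sub>2 b\<close> and \<open>y = k\<^sub>1 a = k\<^sub>2 b\<close>, then \<open>x y\<^sup>-\<^sup>1 = h\<^sub>1 k\<^sub>1\<^sup>-\<^sup>1 = h\<^sub>2 k\<^sub>2\<^sup>-\<^sup>1\<close> lies in the intersection, at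
  distance \<open>gd \<one> y\<close> from \<open>x\<close>. There are finitely many pairs \<open>(a, b)\<close> of bounded length, so one \<open>y\<close> for
  each of them suffices.
\<close>

lemma near_intersection:
  assumes "subgroup H\<^sub>1 G" "subgroup H\<^sub>2 G"
  shows "\<exists>R. \<forall>x\<in>carrier G. (\<exists>h\<in>H\<^sub>1. gd x h \<le> M) \<and> (\<exists>h\<in>H\<^sub>2. gd x h \<le> M) \<longrightarrow>
    (\<exists>h\<in>H\<^sub>1 \<inter> H\<^sub>2. gd x h \<le> R)"
proof -
  interpret A: subgroup H\<^sub>1 G by fact
  interpret B: subgroup H\<^sub>2 G by fact
  let ?Q = "\<lambda>(a, b) y. y \<in> carrier G \<and> y \<otimes> inv a \<in> H\<^sub>1 \<and> y \<otimes> inv b \<in> H\<^sub>2"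
  define y where "y p = (SOME y. ?Q p y)" for p
  let ?BB = "word_ball M \<times> word_ball M"
  let ?R = "\<Sum>p\<in>?BB. gd \<one> (y p)"
  have "\<exists>h\<in>H\<^sub>1 \<inter> H\<^sub>2. gd x h \<le> ?R"
    if x: "x \<in> carrier G" and h: "h1 \<in> H\<^sub>1" "gd x h1 \<le> M" "h2 \<in> H\<^sub>2" "gd x h2 \<le> M" for x h1 h2
  proof -
    let ?a = "inv h1 \<otimes> x" and ?b = "inv h2 \<otimes> x"
    have hG: "h1 \<in> carrier G" "h2 \<in> carrier G" using h by auto
    have ab: "?a \<in> word_ball M" "?b \<in> word_ball M"
      using h x hG gd_translate_one[of h1 x] gd_translate_one[of h2 x]
        gd_sym[of h1 x] gd_sym[of h2 x] by (auto simp: word_ball_def)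
    have "?Q (?a, ?b) x" using x hG h by (simp add: inv_mult_group m_assoc[symmetric])
    then have y: "?Q (?a, ?b) (y (?a, ?b))" unfolding y_def by (rule someI)
    let ?y = "y (?a, ?b)"
    have yG: "?y \<in> carrier G" "?y \<otimes> inv ?a \<in> H\<^sub>1" "?y \<otimes> inv ?b \<in> H\<^sub>2" using y by auto
    let ?k = "x \<otimes> inv ?y"
    have "h1 \<otimes> inv (?y \<otimes> inv ?a) = ?k" "h2 \<otimes> inv (?y \<otimes> inv ?b) = ?k"
      using x hG yG(1) by (simp_all add: inv_mult_group m_assoc[symmetric])
    then have k: "?k \<in> H\<^sub>1" "?k \<in> H\<^sub>2"
      using h yG by (metis A.m_closed A.m_inv_closed, metis B.m_closed B.m_inv_closed)
    have "gd x ?k = gd (?k \<otimes> ?y) (?k \<otimes> \<one>)" using x yG by (simp add: m_assoc)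
    also have "\<dots> = gd ?y \<one>" using x yG by (intro gd_translate) auto
    also have "\<dots> = gd \<one> ?y" using yG by (intro gd_sym) auto
    also have "\<dots> \<le> ?R"
      using member_le_sum[of "(?a, ?b)" ?BB "\<lambda>p. gd \<one> (y p)"] ab finite_word_ball by simp
    finally show ?thesis using k by blast
  qed
  then show ?thesis by blast
qed

lemma vertex_morse_Int:
  assumes "subgroup H\<^sub>1 G" "subgroup H\<^sub>2 G"
    and morse: "vertex_morse EG (carrier G) H\<^sub>1" "vertex_morse EG (carrier G) H\<^sub>2"
  shows "vertex_morse EG (carrier G) (H\<^sub>1 \<inter> H\<^sub>2)"
  unfolding vertex_morse_def
proof (intro conjI allI impI)
  show "H\<^sub>1 \<inter> H\<^sub>2 \<subseteq> carrier G" using morse by (auto simp: vertex_morse_def)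
  fix K C :: real assume K: "1 \<le> K" "0 \<le> C"
  obtain M1 M2 where M12: "morse_radius EG (carrier G) H\<^sub>1 K C M1" "morse_radius EG (carrier G) H\<^sub>2 K C M2"
    using morse K unfolding vertex_morse_def by blast
  define M where "M = max M1 M2"
  have M: "morse_radius EG (carrier G) H\<^sub>1 K C M" "morse_radius EG (carrier G) H\<^sub>2 K C M"
    using morse_radius_mono[OF M12(1) K(1) order_refl order_refl]
      morse_radius_mono[OF M12(2) K(1) order_refl order_refl] by (auto simp: M_def)
  obtain R where R: "\<forall>x\<in>carrier G. (\<exists>h\<in>H\<^sub>1. gd x h \<le> M) \<and> (\<exists>h\<in>H\<^sub>2. gd x h \<le> M) \<longrightarrow>
      (\<exists>h\<in>H\<^sub>1 \<inter> H\<^sub>2. gd x h \<le> R)"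
    using near_intersection[OF assms(1,2)] by blast
  have "morse_radius EG (carrier G) (H\<^sub>1 \<inter> H\<^sub>2) K C R"
    unfolding morse_radius_def
  proof (intro allI impI)
    fix n x i assume "vertex_quasi_geodesic EG (carrier G) K C n x \<and> x 0 \<in> H\<^sub>1 \<inter> H\<^sub>2 \<and> x n \<in> H\<^sub>1 \<inter> H\<^sub>2"
      and i: "i \<le> n"
    then have x: "vertex_quasi_geodesic EG (carrier G) K C n x"
      and ends: "x 0 \<in> H\<^sub>1" "x n \<in> H\<^sub>1" "x 0 \<in> H\<^sub>2" "x n \<in> H\<^sub>2" by auto
    have "\<exists>h\<in>H\<^sub>1. gd (x i) h \<le> M" "\<exists>h\<in>H\<^sub>2. gd (x i) h \<le> M"
      using M x ends i unfolding morse_radius_def by blast+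
    moreover have "x i \<in> carrier G" using x i by (simp add: vertex_quasi_geodesic_def)
    ultimately show "\<exists>h\<in>H\<^sub>1 \<inter> H\<^sub>2. gd (x i) h \<le> R" using R by blast
  qed
  then show "\<exists>M. morse_radius EG (carrier G) (H\<^sub>1 \<inter> H\<^sub>2) K C M" by blast
qed

lemma strongly_quasiconvex_Int:
  assumes "strongly_quasiconvex G H\<^sub>1" "strongly_quasiconvex G H\<^sub>2"
  shows "strongly_quasiconvex G (H\<^sub>1 \<inter> H\<^sub>2)"
  using assms strongly_quasiconvex_if_vertex_morse subgroups_Inter_pair
    vertex_morse_Int vertex_morse_if_strongly_quasiconvex
  by (meson strongly_quasiconvex_def)

lemma strongly_quasiconvex_in_subgroup:
  assumes qcH: "strongly_quasiconvex G H" and qcK: "strongly_quasiconvex G K" and "K \<subseteq> H"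
  shows "strongly_quasiconvex (G\<lparr>carrier := H\<rparr>) K"
proof -
  have H: "subgroup H G" and K: "subgroup K G"
    using assms by (auto simp: strongly_quasiconvex_def)
  obtain T where T: "finite_generating_set (G\<lparr>carrier := H\<rparr>) T"
    using finitely_generated_if_strongly_quasiconvex[OF qcH] by (auto simp: finitely_generated_def)
  interpret H: word_metric "G\<lparr>carrier := H\<rparr>" T
    using subgroup.subgroup_is_group[OF H group_axioms] T
    by (simp add: word_metric_def word_metric_axioms_def)
  obtain L where L: "\<forall>x\<in>H. \<forall>y\<in>H. gd x y \<le> L * vertex_distance H.EG x y"
    using word_dist_lipschitz[OF H T] by blast
  obtain L' where L': "\<forall>x\<in>H. \<forall>y\<in>H. vertex_distance H.EG x y \<le> L' * gd x y"
    using word_dist_undistorted[OF qcH T] by blast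
  have "vertex_morse H.EG H K"
    using vertex_morse_transfer[OF vertex_morse_if_strongly_quasiconvex[OF qcK]
        subgroup.subset[OF H] \<open>K \<subseteq> H\<close>] L L' by blast
  moreover have "subgroup K (G\<lparr>carrier := H\<rparr>)" using subgroup_incl[OF K H \<open>K \<subseteq> H\<close>] .
  ultimately show ?thesis using H.strongly_quasiconvex_if_vertex_morse by simp
qed


section \<open>Packing, width and height\<close>

lemma uniform_morse_radius:
  assumes "finite \<H>" "\<And>H. H \<in> \<H> \<Longrightarrow> strongly_quasiconvex G H"
  shows "\<exists>M. \<forall>H\<in>\<H>. morse_radius EG (carrier G) H 16 0 M"
proof -
  have "\<exists>M. morse_radius EG (carrier G) H 16 0 M" if "H \<in> \<H>" for H
  proof -
    have "(1::real) \<le> 16" "(0::real) \<le> 0" by simp_all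
    then show ?thesis
      using vertex_morse_if_strongly_quasiconvex[OF assms(2)[OF that]]
      unfolding vertex_morse_def by blast
  qed
  then obtain f where f: "\<And>H. H \<in> \<H> \<Longrightarrow> morse_radius EG (carrier G) H 16 0 (f H)" by metis
  have "morse_radius EG (carrier G) H 16 0 (sum f \<H>)" if "H \<in> \<H>" for H
    using morse_radius_mono[OF f[OF that], of 16 0 "sum f \<H>"] member_le_sum[OF that, of f] assms(1)
    by simp
  then show ?thesis by blast
qed

lemma coset_point: "g \<in> carrier G \<Longrightarrow> subgroup H G \<Longrightarrow> g \<in> g <# H"
  by (force simp: l_coset_def intro: subgroup.one_closed)

text \<open>
  All cosets in \<open>P\<close> meet one ball of fixed radius around a common near point \<open>v\<close>; and a coset of a
  given subgroup is determined by any of its elements.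
\<close>

lemma card_close_cosets:
  assumes fin: "finite \<H>" and sub: "\<And>H. H \<in> \<H> \<Longrightarrow> subgroup H G"
    and M: "\<And>H. H \<in> \<H> \<Longrightarrow> morse_radius EG (carrier G) H 16 0 M"
    and P: "essentially_distinct G \<H> P" "finite P"
    and close: "\<And>g H g' H'. (g, H) \<in> P \<Longrightarrow> (g', H') \<in> P \<Longrightarrow> (g, H) \<noteq> (g', H') \<Longrightarrow>
      \<exists>a\<in>g <# H. \<exists>b\<in>g' <# H'. gd a b \<le> D"
  shows "card P \<le> card (word_ball (12 * M + 10 * D + 2)) * card \<H>"
proof (cases "P = {}")
  case False
  let ?R = "12 * M + 10 * D + 2"
  let ?\<A> = "(\<lambda>(g, H). g <# H) ` P"
  have PG: "g \<in> carrier G" "H \<in> \<H>" if "(g, H) \<in> P" for g H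
    using P(1) that by (auto simp: essentially_distinct_def)
  have cG: "g <# H \<subseteq> carrier G" if "(g, H) \<in> P" for g H
    using l_coset_subset_G[OF subgroup.subset[OF sub[OF PG(2)[OF that]]] PG(1)[OF that]] .
  have ne: "g \<in> g <# H" if "(g, H) \<in> P" for g H
    using coset_point[OF PG(1)[OF that] sub[OF PG(2)[OF that]]] .
  have "\<exists>v\<in>carrier G. \<forall>A\<in>?\<A>. \<exists>a\<in>A. gd v a \<le> ?R"
  proof (rule common_near_point)
    show "finite ?\<A>" "?\<A> \<noteq> {}" using P(2) False by auto
    show "morse_radius EG (carrier G) A 16 0 M" "A \<subseteq> carrier G \<and> A \<noteq> {}" if "A \<in> ?\<A>" for A
    proof -
      obtain g H where gH: "(g, H) \<in> P" "A = g <# H" using \<open>A \<in> ?\<A>\<close> by auto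
      show "morse_radius EG (carrier G) A 16 0 M"
        unfolding gH(2) using PG[OF gH(1)] M subgroup.subset[OF sub] by (intro morse_radius_coset) auto
      show "A \<subseteq> carrier G \<and> A \<noteq> {}" using cG[OF gH(1)] ne[OF gH(1)] gH(2) by blast
    qed
    show "\<exists>a\<in>A. \<exists>b\<in>B. gd a b \<le> D" if AB: "A \<in> ?\<A>" "B \<in> ?\<A>" for A B
    proof -
      obtain g H g' H' where gH: "(g, H) \<in> P" "A = g <# H" "(g', H') \<in> P" "B = g' <# H'"
        using AB by auto
      show ?thesis
      proof (cases "(g, H) = (g', H')")
        case True
        then have "g \<in> A" "g \<in> B" "gd g g \<le> D" using ne[OF gH(1)] gH by auto
        then show ?thesis by blast
      next
        case False
        then show ?thesis using close[OF gH(1,3)] gH by blast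
      qed
    qed
  qed
  then obtain v where v: "v \<in> carrier G" "\<And>g H. (g, H) \<in> P \<Longrightarrow> \<exists>a\<in>g <# H. gd v a \<le> ?R" by force
  obtain a where a: "\<And>g H. (g, H) \<in> P \<Longrightarrow> a g H \<in> g <# H \<and> gd v (a g H) \<le> ?R"
    using v(2) by metis
  let ?F = "\<lambda>(g, H). (inv v \<otimes> a g H, H)"
  have "inj_on ?F P"
  proof (rule inj_onI)
    fix p q assume pq: "p \<in> P" "q \<in> P" "?F p = ?F q"
    obtain g H g' H' where eq: "p = (g, H)" "q = (g', H')" by (metis surj_pair)
    have gH: "(g, H) \<in> P" "(g', H') \<in> P" using pq eq by auto
    have "H' = H" "inv v \<otimes> a g H = inv v \<otimes> a g' H'" using pq(3) eq by auto
    moreover have "a g H \<in> carrier G" "a g' H' \<in> carrier G" using a gH cG by blast+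
    ultimately have same: "a g H = a g' H" using v(1) by simp
    have "g <# H = a g H <# H" "g' <# H' = a g H <# H"
      using l_repr_independence[of "a g H" g H] l_repr_independence[of "a g H" g' H]
        a gH PG sub same \<open>H' = H\<close> by (metis)+
    then show "p = q" using P(1) gH eq unfolding essentially_distinct_def inj_on_def by force
  qed
  moreover have "?F ` P \<subseteq> word_ball ?R \<times> \<H>"
  proof clarify
    fix g H assume gH: "(g, H) \<in> P"
    have "a g H \<in> carrier G" using a[OF gH] cG[OF gH] by blast
    then show "inv v \<otimes> a g H \<in> word_ball ?R \<and> H \<in> \<H>"
      using a[OF gH] v(1) PG[OF gH] gd_translate_one[of v "a g H"] by (simp add: word_ball_def)
  qed
  ultimately have "card P \<le> card (word_ball ?R \<times> \<H>)"
    using card_inj_on_le fin finite_word_ball by blast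
  then show ?thesis by (simp add: card_cartesian_product)
qed simp

text \<open>
  For \<open>k\<close> in both conjugates, right multiplication gives \<open>k \<otimes> g\<^sub>1\<close> in the first coset and \<open>k \<otimes> g\<^sub>2\<close>
  in the second, always at the same distance from each other. An infinite intersection contains such
  \<open>k\<close> arbitrarily far away, so the two cosets fellow-travel.
\<close>

lemma close_if_infinite_conjugate_Int:
  assumes H: "subgroup H\<^sub>1 G" "subgroup H\<^sub>2 G"
    and M: "morse_radius EG (carrier G) H\<^sub>1 16 0 M" "morse_radius EG (carrier G) H\<^sub>2 16 0 M"
    and g: "g\<^sub>1 \<in> carrier G" "g\<^sub>2 \<in> carrier G"
    and inf: "infinite (conjugate G g\<^sub>1 H\<^sub>1 \<inter> conjugate G g\<^sub>2 H\<^sub>2)"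
  shows "\<exists>a\<in>g\<^sub>1 <# H\<^sub>1. \<exists>b\<in>g\<^sub>2 <# H\<^sub>2. gd a b \<le> 2 * M"
proof -
  let ?I = "conjugate G g\<^sub>1 H\<^sub>1 \<inter> conjugate G g\<^sub>2 H\<^sub>2"
  let ?r = "gd g\<^sub>1 g\<^sub>2"
  have HG: "H\<^sub>1 \<subseteq> carrier G" "H\<^sub>2 \<subseteq> carrier G" using H subgroup.subset by auto
  have coset: "k \<in> carrier G" "k \<otimes> g \<in> g <# H"
    if k: "k \<in> conjugate G g H" and "g \<in> carrier G" "H \<subseteq> carrier G" for k g H
  proof -
    obtain h where h: "h \<in> H" "k = g \<otimes> h \<otimes> inv g" using k by (auto simp: conjugate_iff)
    have "h \<in> carrier G" using h that by blast
    then show "k \<in> carrier G" "k \<otimes> g \<in> g <# H"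
      using h that by (auto simp: l_coset_def m_assoc)
  qed
  have IG: "?I \<subseteq> carrier G" using coset(1) g HG by blast
  have "\<exists>k\<in>?I. 6 * ?r < gd g\<^sub>2 (k \<otimes> g\<^sub>2)"
  proof (rule ccontr)
    assume "\<not> ?thesis"
    then have small: "gd g\<^sub>2 (k \<otimes> g\<^sub>2) \<le> 6 * ?r" if "k \<in> ?I" for k
      using that not_less by blast
    have "inj_on (\<lambda>k. inv g\<^sub>2 \<otimes> (k \<otimes> g\<^sub>2)) ?I"
    proof (rule inj_onI)
      fix k l assume kl: "k \<in> ?I" "l \<in> ?I" "inv g\<^sub>2 \<otimes> (k \<otimes> g\<^sub>2) = inv g\<^sub>2 \<otimes> (l \<otimes> g\<^sub>2)"
      have "k \<in> carrier G" "l \<in> carrier G" using kl(1,2) IG by blast+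
      then show "k = l" using kl(3) g by simp
    qed
    moreover have "(\<lambda>k. inv g\<^sub>2 \<otimes> (k \<otimes> g\<^sub>2)) ` ?I \<subseteq> word_ball (6 * ?r)"
    proof
      fix z assume "z \<in> (\<lambda>k. inv g\<^sub>2 \<otimes> (k \<otimes> g\<^sub>2)) ` ?I"
      then obtain k where k: "k \<in> ?I" "z = inv g\<^sub>2 \<otimes> (k \<otimes> g\<^sub>2)" by blast
      have "k \<in> carrier G" using k IG by blast
      then show "z \<in> word_ball (6 * ?r)"
        using small[OF k(1)] k(2) g gd_translate_one[of g\<^sub>2 "k \<otimes> g\<^sub>2"] by (simp add: word_ball_def)
    qed
    ultimately have "finite ?I" using finite_word_ball by (meson finite_imageD finite_subset)
    then show False using inf by blast
  qed
  then obtain k where k: "k \<in> ?I" "6 * ?r < gd g\<^sub>2 (k \<otimes> g\<^sub>2)" by blast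
  have kG: "k \<in> carrier G" using k IG by blast
  have "gd (k \<otimes> g\<^sub>1) (k \<otimes> g\<^sub>2) = ?r" using gd_translate[OF kG g] .
  then show ?thesis
    using close_if_fellow_travelling[of "g\<^sub>1 <# H\<^sub>1" M "g\<^sub>2 <# H\<^sub>2" g\<^sub>1 "k \<otimes> g\<^sub>1" g\<^sub>2 "k \<otimes> g\<^sub>2" ?r]
      morse_radius_coset[OF morse_radius_mono[OF M(1), of 1 0 M] HG(1) g(1)]
      morse_radius_coset[OF morse_radius_mono[OF M(2), of 2 0 M] HG(2) g(2)]
      l_coset_subset_G[OF HG(1) g(1)] l_coset_subset_G[OF HG(2) g(2)]
      coset_point[OF g(1) H(1)] coset_point[OF g(2) H(2)]
      coset(2)[OF _ g(1) HG(1)] coset(2)[OF _ g(2) HG(2)] k by simp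
qed

lemma finite_width_if_strongly_quasiconvex:
  assumes fin: "finite \<H>" and qc: "\<And>H. H \<in> \<H> \<Longrightarrow> strongly_quasiconvex G H"
  shows "finite_width G \<H>"
proof -
  obtain M where M: "\<And>H. H \<in> \<H> \<Longrightarrow> morse_radius EG (carrier G) H 16 0 M"
    using uniform_morse_radius[OF assms] by blast
  have sub: "subgroup H G" if "H \<in> \<H>" for H using qc[OF that] by (simp add: strongly_quasiconvex_def)
  let ?n = "card (word_ball (12 * M + 10 * (2 * M) + 2)) * card \<H>"
  have "finite P \<and> card P \<le> ?n"
    if P: "essentially_distinct G \<H> P" and inf: "\<forall>(g, H)\<in>P. \<forall>(g', H')\<in>P.
      (g, H) \<noteq> (g', H') \<longrightarrow> infinite (conjugate G g H \<inter> conjugate G g' H')" for P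
  proof (rule finite_if_finite_subsets_card_bdd)
    fix Q assume Q: "Q \<subseteq> P" "finite Q"
    have Q': "essentially_distinct G \<H> Q"
      using P Q(1) inj_on_subset unfolding essentially_distinct_def by blast
    show "card Q \<le> ?n"
    proof (rule card_close_cosets[OF fin sub M Q' Q(2)])
      fix g H g' H' assume gH: "(g, H) \<in> Q" "(g', H') \<in> Q" "(g, H) \<noteq> (g', H')"
      then have "g \<in> carrier G" "H \<in> \<H>" "g' \<in> carrier G" "H' \<in> \<H>"
        using P Q(1) by (auto simp: essentially_distinct_def)
      moreover have "infinite (conjugate G g H \<inter> conjugate G g' H')"
      proof -
        have P': "(g, H) \<in> P" "(g', H') \<in> P" using gH Q(1) by auto
        have "\<forall>(g', H')\<in>P. (g, H) \<noteq> (g', H') \<longrightarrow>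
            infinite (conjugate G g H \<inter> conjugate G g' H')"
          using bspec[OF inf P'(1)] by (simp only: prod.case)
        from bspec[OF this P'(2)] gH(3) show ?thesis by auto
      qed
      ultimately show "\<exists>a\<in>g <# H. \<exists>b\<in>g' <# H'. gd a b \<le> 2 * M"
        using sub M by (intro close_if_infinite_conjugate_Int) auto
    qed
  qed
  then show ?thesis unfolding finite_width_def by blast
qed

lemma finite_height_if_finite_width:
  assumes "finite_width G \<H>"
  shows "finite_height G \<H>"
proof -
  obtain n where n: "\<And>P. essentially_distinct G \<H> P \<Longrightarrow> (\<forall>(g, H)\<in>P. \<forall>(g', H')\<in>P.
      (g, H) \<noteq> (g', H') \<longrightarrow> infinite (conjugate G g H \<inter> conjugate G g' H')) \<Longrightarrow> card P \<le> n"
    using assms unfolding finite_width_def by blast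
  have "finite (\<Inter>(g, H)\<in>P. conjugate G g H)"
    if P: "essentially_distinct G \<H> P" "card P = n + 1" for P
  proof (rule ccontr)
    assume inf: "infinite (\<Inter>(g, H)\<in>P. conjugate G g H)"
    have "infinite (conjugate G g H \<inter> conjugate G g' H')" if "(g, H) \<in> P" "(g', H') \<in> P" for g H g' H'
    proof -
      have "(\<Inter>(g, H)\<in>P. conjugate G g H) \<subseteq> conjugate G g H \<inter> conjugate G g' H'" using that by blast
      then show ?thesis using inf finite_subset by blast
    qed
    then have "card P \<le> n" using n[OF P(1)] by blast
    then show False using P(2) by simp
  qed
  then show ?thesis unfolding finite_height_def height_at_most_def by blast
qed

lemma set_distance_less:
  assumes "set_distance (cayley_graph G S) (vertex_point ` A) (vertex_point ` B) < D"
    and "A \<subseteq> carrier G" "B \<subseteq> carrier G" "A \<noteq> {}" "B \<noteq> {}"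
  shows "\<exists>a\<in>A. \<exists>b\<in>B. real (gd a b) < D"
proof -
  let ?F = "(\<lambda>(a, b). mdist (cayley_graph G S) a b) ` (vertex_point ` A \<times> vertex_point ` B)"
  have "?F \<noteq> {}" using assms(4,5) by simp
  moreover have "Inf ?F < D" using assms(1) unfolding set_distance_def .
  ultimately have "\<exists>r\<in>?F. r < D" by (rule cInf_lessD)
  then obtain a b where "a \<in> A" "b \<in> B"
    "mdist (cayley_graph G S) (vertex_point a) (vertex_point b) < D" by auto
  moreover from this have "mdist (cayley_graph G S) (vertex_point a) (vertex_point b) = gd a b"
    unfolding cayley_graph_def using assms by (intro mdist_vertices) auto
  ultimately show ?thesis by force
qed

lemma packing_bound:
  assumes fin: "finite \<H>" and qc: "\<And>H. H \<in> \<H> \<Longrightarrow> strongly_quasiconvex G H" and D: "0 \<le> D"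
  shows "\<exists>N::nat. \<forall>P. essentially_distinct G \<H> P \<and> finite P \<and> card P = N \<longrightarrow>
    (\<exists>(g, H)\<in>P. \<exists>(g', H')\<in>P. (g, H) \<noteq> (g', H') \<and>
       D \<le> set_distance (cayley_graph G S) (vertex_point ` (g <# H)) (vertex_point ` (g' <# H')))"
proof -
  obtain M where M: "\<And>H. H \<in> \<H> \<Longrightarrow> morse_radius EG (carrier G) H 16 0 M"
    using uniform_morse_radius[OF fin qc] by blast
  have sub: "subgroup H G" if "H \<in> \<H>" for H using qc[OF that] by (simp add: strongly_quasiconvex_def)
  define d where "d = nat \<lfloor>D\<rfloor>"
  let ?n = "card (word_ball (12 * M + 10 * d + 2)) * card \<H>"
  define sep where "sep = (\<lambda>(g, H) (g', H'). D \<le> set_distance (cayley_graph G S)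
    (vertex_point ` (g <# H)) (vertex_point ` (g' <# H')))"
  have "\<exists>p\<in>P. \<exists>q\<in>P. p \<noteq> q \<and> sep p q"
    if P: "essentially_distinct G \<H> P" "finite P" "card P = ?n + 1" for P
  proof (rule ccontr)
    assume "\<not> ?thesis"
    then have "\<not> sep (g, H) (g', H')"
      if "(g, H) \<in> P" "(g', H') \<in> P" "(g, H) \<noteq> (g', H')" for g H g' H'
      using that by blast
    then have near: "set_distance (cayley_graph G S)
        (vertex_point ` (g <# H)) (vertex_point ` (g' <# H')) < D"
      if "(g, H) \<in> P" "(g', H') \<in> P" "(g, H) \<noteq> (g', H')" for g H g' H'
      using that by (simp add: sep_def not_le[symmetric])
    have "card P \<le> ?n"
    proof (rule card_close_cosets[OF fin sub M P(1,2)])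
      fix g H g' H' assume gH: "(g, H) \<in> P" "(g', H') \<in> P" "(g, H) \<noteq> (g', H')"
      have V: "g \<in> carrier G" "H \<in> \<H>" "g' \<in> carrier G" "H' \<in> \<H>"
        using P(1) gH by (auto simp: essentially_distinct_def)
      have "\<exists>a\<in>g <# H. \<exists>b\<in>g' <# H'. real (gd a b) < D"
        using near[OF gH] l_coset_subset_G[OF subgroup.subset[OF sub[OF V(2)]] V(1)]
          l_coset_subset_G[OF subgroup.subset[OF sub[OF V(4)]] V(3)]
          coset_point[OF V(1) sub[OF V(2)]] coset_point[OF V(3) sub[OF V(4)]]
        by (intro set_distance_less) auto
      then obtain a b where "a \<in> g <# H" "b \<in> g' <# H'" "real (gd a b) < D" by blast
      moreover from this have "gd a b \<le> d" unfolding d_def by linarith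
      ultimately show "\<exists>a\<in>g <# H. \<exists>b\<in>g' <# H'. gd a b \<le> d" by blast
    qed
    then show False using P(3) by simp
  qed
  then have bound: "\<exists>(g, H)\<in>P. \<exists>(g', H')\<in>P. (g, H) \<noteq> (g', H') \<and>
       D \<le> set_distance (cayley_graph G S) (vertex_point ` (g <# H)) (vertex_point ` (g' <# H'))"
    if "essentially_distinct G \<H> P" "finite P" "card P = ?n + 1" for P
    using that by (simp add: sep_def split_beta prod_eq_iff)
  show ?thesis by (intro exI[of _ "?n + 1"] allI impI bound) simp_all
qed

end


section \<open>The commensurator\<close>

context group
begin

lemma subgroup_subset_commensurator:
  assumes H: "subgroup H G"
  shows "H \<subseteq> commensurator G H"
proof
  interpret H: subgroup H G by fact
  fix h assume h: "h \<in> H"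
  have "conjugate G h H = H"
  proof -
    have "h <# H = H" using h H by (simp add: coset_join3)
    moreover have "H #> inv h = H" using h H by (simp add: coset_join2)
    ultimately show ?thesis by (simp add: conjugate_def)
  qed
  moreover have "finite (rcosets\<^bsub>G\<lparr>carrier := H\<rparr>\<^esub> H)"
  proof -
    have "rcosets\<^bsub>G\<lparr>carrier := H\<rparr>\<^esub> H \<subseteq> {H}"
      using coset_join2[OF _ H] by (auto simp: RCOSETS_def r_coset_def)
    then show ?thesis using finite_subset by blast
  qed
  ultimately show "h \<in> commensurator G H" using h by (simp add: commensurator_def finite_index_def)
qed

text \<open>
  If \<open>c\<close> commensurates \<open>H\<close>, then \<open>H\<close> meets the conjugate of \<open>H\<close> by \<open>inv c\<close> in a subgroup of finite
  index. The intersection of finitely many subgroups of finite index in the infinite group \<open>H\<close> is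
  infinite, so the height bounds the number of cosets of \<open>H\<close> in the commensurator. The inverse appears
  because the index counts right cosets \<open>H #> c\<close> while the height concerns left cosets \<open>inv c <# H\<close>.
\<close>

lemma finite_index_commensurator:
  assumes H: "subgroup H G" and inf: "infinite H" and height: "height_at_most G {H} n"
  shows "finite_index G (commensurator G H) H"
proof -
  interpret H: subgroup H G by fact
  have cancel: "a \<otimes> (inv a \<otimes> b) = b" "inv a \<otimes> (a \<otimes> b) = b"
    if "a \<in> carrier G" "b \<in> carrier G" for a b
    using that by (simp_all add: m_assoc[symmetric])
  let ?C = "commensurator G H"
  have CG: "?C \<subseteq> carrier G" by (auto simp: commensurator_def)
  have "finite ((#>) H ` ?C)"
  proof (rule ccontr)
    assume "infinite ((#>) H ` ?C)"
    then obtain X where X: "X \<subseteq> (#>) H ` ?C" "finite X" "card X = n + 1"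
      using infinite_arbitrarily_large by blast
    obtain C where C: "C \<subseteq> ?C" "inj_on ((#>) H) C" "X = (#>) H ` C"
      using X(1) unfolding subset_image_inj by blast
    have finC: "finite C" "card C = n + 1"
      using X(2,3) C(3) finite_imageD[OF _ C(2)] card_image[OF C(2)] by simp_all
    let ?P = "(\<lambda>c. (inv c, H)) ` C"
    have "inj_on (\<lambda>(g, H). g <# H) ?P"
    proof (rule inj_onI, clarify)
      fix c d assume cd: "c \<in> C" "d \<in> C" "inv c <# H = inv d <# H"
      have G: "c \<in> carrier G" "d \<in> carrier G" using cd C(1) CG by auto
      have "inv c \<otimes> \<one> \<in> inv c <# H" using H.one_closed unfolding l_coset_def by blast
      then have "inv c \<in> inv d <# H" using cd(3) G by simp
      then obtain h where h: "h \<in> H" "inv c = inv d \<otimes> h" by (auto simp: l_coset_def)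
      have "d \<otimes> inv c = h" using h G by (simp add: m_assoc[symmetric])
      moreover have "d = (d \<otimes> inv c) \<otimes> c" using G by (simp add: m_assoc)
      ultimately have "d = h \<otimes> c" by simp
      then have "d \<in> H #> c" using h(1) unfolding r_coset_def by blast
      then have "H #> c = H #> d" using repr_independence[OF _ G(1) H] by blast
      then have "c = d" using C(2) cd by (auto dest: inj_onD)
      then show "inv c = inv d \<and> H = H" by simp
    qed
    then have "essentially_distinct G {H} ?P"
      using C(1) CG by (auto simp: essentially_distinct_def)
    moreover have "card ?P = n + 1"
    proof -
      have "inj_on (\<lambda>c. (inv c, H)) C"
        using C(1) CG inj_on_subset[OF inv_inj, of C] by (auto simp: inj_on_def)
      then show ?thesis using finC by (simp add: card_image)
    qed
    ultimately have fin: "finite (\<Inter>(g, K)\<in>?P. conjugate G g K)"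
      using height unfolding height_at_most_def by blast
    let ?K = "\<lambda>c. H \<inter> conjugate G c H"
    \<comment> \<open>By the pigeonhole principle infinitely many \<open>h\<close> agree, simultaneously for all \<open>c\<close>, on the
      coset of \<open>?K c\<close> that contains the conjugate of \<open>h\<close> by \<open>c\<close>; their quotients lie in all the
      conjugates of \<open>H\<close>.\<close>
    define \<phi> where "\<phi> h = (\<lambda>c\<in>C. ?K c #> (c \<otimes> h \<otimes> inv c))" for h
    let ?R = "\<lambda>c. rcosets\<^bsub>G\<lparr>carrier := conjugate G c H\<rparr>\<^esub> ?K c"
    have "\<phi> ` H \<subseteq> PiE C ?R"
    proof
      fix f assume "f \<in> \<phi> ` H"
      then obtain h where h: "h \<in> H" "f = \<phi> h" by blast
      have "?K c #> (c \<otimes> h \<otimes> inv c) \<in> ?R c" if "c \<in> C" for c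
      proof -
        have "c \<otimes> h \<otimes> inv c \<in> conjugate G c H" using h conjugate_iff by blast
        then show ?thesis unfolding RCOSETS_def by (auto simp: r_coset_def)
      qed
      then show "f \<in> PiE C ?R" using h by (auto simp: \<phi>_def)
    qed
    moreover have "finite (PiE C ?R)"
      using finC C(1) by (intro finite_PiE) (auto simp: commensurator_def finite_index_def)
    ultimately have "finite (\<phi> ` H)" using finite_subset by blast
    then obtain h0 where h0: "h0 \<in> H" "infinite {h \<in> H. \<phi> h = \<phi> h0}"
      using pigeonhole_infinite[OF inf] by blast
    have "inj_on (\<lambda>h. h \<otimes> inv h0) {h \<in> H. \<phi> h = \<phi> h0}"
      using h0 by (intro inj_onI) auto
    then have "infinite ((\<lambda>h. h \<otimes> inv h0) ` {h \<in> H. \<phi> h = \<phi> h0})"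
      using h0(2) finite_imageD by blast
    moreover have "(\<lambda>h. h \<otimes> inv h0) ` {h \<in> H. \<phi> h = \<phi> h0} \<subseteq> (\<Inter>(g, K)\<in>?P. conjugate G g K)"
    proof clarify
      fix h c assume h: "h \<in> H" "\<phi> h = \<phi> h0" and c: "c \<in> C"
      have G: "c \<in> carrier G" "h \<in> carrier G" "h0 \<in> carrier G" using c C(1) CG h h0 by auto
      let ?x = "c \<otimes> h \<otimes> inv c" and ?y = "c \<otimes> h0 \<otimes> inv c"
      have "?K c #> ?x = ?K c #> ?y" using fun_cong[OF h(2), of c] c by (simp add: \<phi>_def)
      moreover have "\<one> \<in> ?K c" using H.one_closed G by (auto simp: conjugate_iff intro!: bexI[of _ \<one>])
      then have "\<one> \<otimes> ?x \<in> ?K c #> ?x" unfolding r_coset_def by blast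
      ultimately have "?x \<in> ?K c #> ?y" using G by simp
      then obtain k where k: "k \<in> H" "?x = k \<otimes> ?y" by (auto simp: r_coset_def)
      have kG: "k \<in> carrier G" using k(1) by simp
      have "h \<otimes> inv h0 = inv c \<otimes> (?x \<otimes> inv ?y) \<otimes> c"
        using G by (simp add: inv_mult_group m_assoc cancel)
      also have "?x \<otimes> inv ?y = k" using k(2) kG G by (simp add: inv_mult_group m_assoc cancel)
      finally have "h \<otimes> inv h0 = inv c \<otimes> k \<otimes> inv (inv c)" using G by simp
      then show "h \<otimes> inv h0 \<in> conjugate G (inv c) H" using k conjugate_iff by blast
    qed
    ultimately show False using fin finite_subset by blast
  qed
  moreover have "rcosets\<^bsub>G\<lparr>carrier := ?C\<rparr>\<^esub> H = (#>) H ` ?C"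
    by (auto simp: RCOSETS_def r_coset_def)
  ultimately show ?thesis using subgroup_subset_commensurator[OF H] by (simp add: finite_index_def)
qed

end


section \<open>Strongly quasiconvex subgroups\<close>

theorem theorem1p2:
  fixes G :: "('a, 'b) monoid_scheme"
  assumes "group G" and "finitely_generated G"
  shows "(\<forall>H. strongly_quasiconvex G H \<longrightarrow>
            finitely_generated (G\<lparr>carrier := H\<rparr>) \<and> undistorted G H \<and>
            (infinite H \<or> finite (carrier G) \<longrightarrow> finite_index G (commensurator G H) H)) \<and>
         (\<forall>H\<^sub>1 H\<^sub>2. strongly_quasiconvex G H\<^sub>1 \<and> strongly_quasiconvex G H\<^sub>2 \<longrightarrow>
            strongly_quasiconvex G (H\<^sub>1 \<inter> H\<^sub>2) \<and>
            strongly_quasiconvex (G\<lparr>carrier := H\<^sub>1\<rparr>) (H\<^sub>1 \<inter> H\<^sub>2) \<and>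
            strongly_quasiconvex (G\<lparr>carrier := H\<^sub>2\<rparr>) (H\<^sub>1 \<inter> H\<^sub>2)) \<and>
         (\<forall>\<H>. finite \<H> \<and> (\<forall>H\<in>\<H>. strongly_quasiconvex G H) \<longrightarrow>
            finite_height G \<H> \<and> finite_width G \<H> \<and> bounded_packing G \<H>)"
proof (intro conjI allI impI)
  obtain S where S: "finite_generating_set G S"
    using assms(2) by (auto simp: finitely_generated_def)
  interpret word_metric G S
    using assms(1) S by (simp add: word_metric_def word_metric_axioms_def)
  have any: "word_metric G S'" if "finite_generating_set G S'" for S'
    using assms(1) that by (simp add: word_metric_def word_metric_axioms_def)
  {
    fix H assume H: "strongly_quasiconvex G H"
    show fg: "finitely_generated (G\<lparr>carrier := H\<rparr>)"
      using finitely_generated_if_strongly_quasiconvex[OF H] .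
    show "undistorted G H"
      unfolding undistorted_def
    proof (intro conjI allI impI)
      show "subgroup H G" using H by (simp add: strongly_quasiconvex_def)
      fix S T assume "finite_generating_set G S \<and> finite_generating_set (G\<lparr>carrier := H\<rparr>) T"
      then show "\<exists>K\<ge>1. \<exists>L\<ge>0. \<exists>\<Phi>. (\<forall>h\<in>H. \<Phi> (vertex_point h) = vertex_point h) \<and>
          qi_embedding (cayley_graph (G\<lparr>carrier := H\<rparr>) T) (cayley_graph G S) K L \<Phi>"
        using word_metric.undistorted_inclusion[OF any H] by blast
    qed (rule fg)
    assume large: "infinite H \<or> finite (carrier G)"
    have sub: "subgroup H G" using H by (simp add: strongly_quasiconvex_def)
    show "finite_index G (commensurator G H) H"
    proof (cases "finite H")
      case False
      have "finite_height G {H}"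
        using H by (intro finite_height_if_finite_width finite_width_if_strongly_quasiconvex) auto
      then show ?thesis
        using finite_index_commensurator[OF sub False] by (auto simp: finite_height_def)
    next
      case True
      then have "finite (commensurator G H)"
        using large finite_subset[of "commensurator G H" "carrier G"]
        by (auto simp: commensurator_def)
      then have "finite (rcosets\<^bsub>G\<lparr>carrier := commensurator G H\<rparr>\<^esub> H)"
        by (simp add: RCOSETS_def)
      then show ?thesis using subgroup_subset_commensurator[OF sub] by (simp add: finite_index_def)
    qed
  next
    fix H\<^sub>1 H\<^sub>2 assume "strongly_quasiconvex G H\<^sub>1 \<and> strongly_quasiconvex G H\<^sub>2"
    then have H: "strongly_quasiconvex G H\<^sub>1" "strongly_quasiconvex G H\<^sub>2" by auto
    show Int: "strongly_quasiconvex G (H\<^sub>1 \<inter> H\<^sub>2)" using strongly_quasiconvex_Int[OF H] .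
    show "strongly_quasiconvex (G\<lparr>carrier := H\<^sub>1\<rparr>) (H\<^sub>1 \<inter> H\<^sub>2)"
      "strongly_quasiconvex (G\<lparr>carrier := H\<^sub>2\<rparr>) (H\<^sub>1 \<inter> H\<^sub>2)"
      using strongly_quasiconvex_in_subgroup[OF _ Int] H by auto
  next
    fix \<H> assume "finite \<H> \<and> (\<forall>H\<in>\<H>. strongly_quasiconvex G H)"
    then have fin: "finite \<H>" and qc: "\<And>H. H \<in> \<H> \<Longrightarrow> strongly_quasiconvex G H" by auto
    show width: "finite_width G \<H>" using finite_width_if_strongly_quasiconvex[OF fin qc] .
    show "finite_height G \<H>" using finite_height_if_finite_width[OF width] .
    show "bounded_packing G \<H>"
      unfolding bounded_packing_def
    proof (intro allI impI)
      fix S' :: "'a set" and D :: real assume S': "finite_generating_set G S'" and D: "0 \<le> D"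
      show "\<exists>N::nat. \<forall>P. essentially_distinct G \<H> P \<and> finite P \<and> card P = N \<longrightarrow>
          (\<exists>(g, H)\<in>P. \<exists>(g', H')\<in>P. (g, H) \<noteq> (g', H') \<and>
             D \<le> set_distance (cayley_graph G S')
               (vertex_point ` (g <#\<^bsub>G\<^esub> H)) (vertex_point ` (g' <#\<^bsub>G\<^esub> H')))"
        using word_metric.packing_bound[OF any[OF S'] fin qc D] .
    qed
  }
qed

end
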